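(* In three dimensions, let $\boldsymbol v^0(\cdot,\boldsymbol\xi)$ be the triple-periodic field of the context. Every phase vector $\boldsymbol\xi\in\mathbb R^3$ which satisfies the reduction condition and for which $\boldsymbol v^0\not\equiv\boldsymbol 0$ belongs to one of the two families $$\text{(first)}\quad \boldsymbol\xi=\left(\theta,\ \theta-\tfrac{2\pi}{3}+\ell_1\pi,\ \theta+\tfrac{\pi}{6}+\ell_2\pi\right),\qquad \text{(second)}\quad \boldsymbol\xi=\left(\theta,\ \theta+\tfrac{2\pi}{3}+\ell_1\pi,\ \theta+\tfrac{5\pi}{6}+\ell_2\pi\right),$$ with $\theta\in\mathbb R$, $\ell_1,\ell_2\in\mathbb Z$. Every member of either family satisfies the reduction condition and the pressure-integrability condition. The helicity $\mathcal H=\int_{[0,2\pi/\alpha)^3}\boldsymbol v^0\cdot(\nabla\times\boldsymbol v^0)\,dV$ equals $$\mathcal H=-\frac{27\sqrt3}{4}\frac{\pi^3v_r^2}{\alpha^2}\ \text{ for the first family},\qquad \mathcal H=+\frac{27\sqrt3}{4}\frac{\pi^3v_r^2}{\alpha^2}\ \text{ for the second family},$$ independently of $\theta,\ell_1,\ell_2$; consequently no translation and no proper rotation carries a member of one family to a member of the other.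
   Context: With $\alpha>0$, $v_r>0$, $$\frac{v_1^0(\boldsymbol x,\boldsymbol\xi)}{v_r}=\sin(\alpha x_1+\xi_1)\cos(\alpha x_2+\xi_2)\sin(\alpha x_3+\xi_3)-\sin(\alpha x_1+\xi_2)\sin(\alpha x_2+\xi_3)\cos(\alpha x_3+\xi_1),$$ with $v_2^0,v_3^0$ obtained by the cyclic coordinate permutations $(x_1,x_2,x_3)\mapsto(x_2,x_3,x_1)$ and $(x_1,x_2,x_3)\mapsto(x_3,x_1,x_2)$ with the same $\boldsymbol\xi$. The convective field is $g_i^0=\sum_{j}v_j^0\,\partial_jv_i^0$; $\mathcal V_i^0$ is the $x_i$-independent part of $g_i^0$ (the sum of its Fourier modes with $k_i=0$). Reduction condition: $\mathcal V_i^0\equiv0$ for $i=1,2,3$. Pressure-integrability condition: $\partial_jg_i^0=\partial_ig_j^0$ identically for all $i,j$. *)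

theory Defs
  imports "HOL-Analysis.Analysis"
begin

definition v1 :: "real \<Rightarrow> real \<Rightarrow> real ^ 3 \<Rightarrow> real ^ 3 \<Rightarrow> real" where
  "v1 \<alpha> vr \<xi> x = vr *
     (sin (\<alpha> * x $ 1 + \<xi> $ 1) * cos (\<alpha> * x $ 2 + \<xi> $ 2) * sin (\<alpha> * x $ 3 + \<xi> $ 3)
      - sin (\<alpha> * x $ 1 + \<xi> $ 2) * sin (\<alpha> * x $ 2 + \<xi> $ 3) * cos (\<alpha> * x $ 3 + \<xi> $ 1))"

definition v0 :: "real \<Rightarrow> real \<Rightarrow> real ^ 3 \<Rightarrow> real ^ 3 \<Rightarrow> real ^ 3" where
  "v0 \<alpha> vr \<xi> x = vector
     [v1 \<alpha> vr \<xi> x,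
      v1 \<alpha> vr \<xi> (vector [x $ 2, x $ 3, x $ 1]),
      v1 \<alpha> vr \<xi> (vector [x $ 3, x $ 1, x $ 2])]"

definition pd :: "3 \<Rightarrow> (real ^ 3 \<Rightarrow> real) \<Rightarrow> real ^ 3 \<Rightarrow> real" where
  "pd j f x = deriv (\<lambda>t. f (x + t *\<^sub>R axis j 1)) 0"

definition curl :: "(real ^ 3 \<Rightarrow> real ^ 3) \<Rightarrow> real ^ 3 \<Rightarrow> real ^ 3" where
  "curl v x = vector
     [pd 2 (\<lambda>y. v y $ 3) x - pd 3 (\<lambda>y. v y $ 2) x,
      pd 3 (\<lambda>y. v y $ 1) x - pd 1 (\<lambda>y. v y $ 3) x,
      pd 1 (\<lambda>y. v y $ 2) x - pd 2 (\<lambda>y. v y $ 1) x]"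

definition convective :: "(real ^ 3 \<Rightarrow> real ^ 3) \<Rightarrow> 3 \<Rightarrow> real ^ 3 \<Rightarrow> real" where
  "convective v i x = (\<Sum>j\<in>UNIV. v x $ j * pd j (\<lambda>y. v y $ i) x)"

definition cell :: "real \<Rightarrow> (real ^ 3) set" where
  "cell \<alpha> = {x. \<forall>i. 0 \<le> x $ i \<and> x $ i < 2 * pi / \<alpha>}"

definition fourier_mode :: "real \<Rightarrow> int ^ 3 \<Rightarrow> real ^ 3 \<Rightarrow> complex" where
  "fourier_mode \<alpha> k x = cis (\<alpha> * (\<Sum>j\<in>UNIV. of_int (k $ j) * x $ j))"

definition fourier_coeff :: "real \<Rightarrow> (real ^ 3 \<Rightarrow> real) \<Rightarrow> int ^ 3 \<Rightarrow> complex" where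
  "fourier_coeff \<alpha> f k =
     complex_of_real ((\<alpha> / (2 * pi)) ^ 3) *
       (LINT x:cell \<alpha>|lborel. complex_of_real (f x) * cnj (fourier_mode \<alpha> k x))"

text \<open>The sum of the Fourier modes of \<open>f\<close> with \<open>k\<^sub>i = 0\<close>. It is only applied to trigonometric
  polynomials, for which all but finitely many summands vanish, so \<open>infsum\<close> is a genuine sum.\<close>
definition independent_part :: "real \<Rightarrow> 3 \<Rightarrow> (real ^ 3 \<Rightarrow> real) \<Rightarrow> real ^ 3 \<Rightarrow> complex" where
  "independent_part \<alpha> i f x =
     (\<Sum>\<^sub>\<infinity>k\<in>{k. k $ i = 0}. fourier_coeff \<alpha> f k * fourier_mode \<alpha> k x)"

definition reduction_condition :: "real \<Rightarrow> (real ^ 3 \<Rightarrow> real ^ 3) \<Rightarrow> bool" where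
  "reduction_condition \<alpha> v \<longleftrightarrow> (\<forall>i x. independent_part \<alpha> i (convective v i) x = 0)"

definition pressure_integrability :: "(real ^ 3 \<Rightarrow> real ^ 3) \<Rightarrow> bool" where
  "pressure_integrability v \<longleftrightarrow> (\<forall>i j x. pd j (convective v i) x = pd i (convective v j) x)"

definition helicity :: "real \<Rightarrow> (real ^ 3 \<Rightarrow> real ^ 3) \<Rightarrow> real" where
  "helicity \<alpha> v = (LINT x:cell \<alpha>|lborel. v x \<bullet> curl v x)"

definition first_family :: "(real ^ 3) set" where
  "first_family =
     {vector [\<theta>, \<theta> - 2 * pi / 3 + of_int l1 * pi, \<theta> + pi / 6 + of_int l2 * pi] |
        (\<theta> :: real) (l1 :: int) (l2 :: int). True}"

definition second_family :: "(real ^ 3) set" where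
  "second_family =
     {vector [\<theta>, \<theta> + 2 * pi / 3 + of_int l1 * pi, \<theta> + 5 * pi / 6 + of_int l2 * pi] |
        (\<theta> :: real) (l1 :: int) (l2 :: int). True}"

text \<open>The motion \<open>x \<mapsto> R x + a\<close> carries the vector field \<open>v\<close> to \<open>w\<close>. Translations are the case
  \<open>R = mat 1\<close>; a rotation about the point \<open>c\<close> is the case \<open>a = c - R c\<close>.\<close>
definition carries ::
    "real ^ 3 ^ 3 \<Rightarrow> real ^ 3 \<Rightarrow> (real ^ 3 \<Rightarrow> real ^ 3) \<Rightarrow> (real ^ 3 \<Rightarrow> real ^ 3) \<Rightarrow> bool" where
  "carries R a v w \<longleftrightarrow> (\<forall>x. w (R *v x + a) = R *v v x)"

end

theory Submission
  imports Defs
begin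

text \<open>
  The proof rests on two features of the field. It has degree exactly one in each coordinate, so
  a partial derivative is \<open>\<alpha>\<close> times a shift by a quarter period (\<open>v0_directional_deriv\<close>), and
  products of two components have only the frequencies \<open>0\<close> and \<open>\<plusminus>2\<close> in each coordinate. For such
  functions the Fourier projection onto the modes with \<open>k\<^sub>i = 0\<close> is the mean of the values at two
  points a quarter period apart (\<open>independent_part_eq\<close>), and the integral over the cell is an
  eight-point mean (\<open>cell_integral_eq\<close>). The analytic conditions thereby become trigonometric
  identities.

  For the members of the families the field is a Beltrami field: \<open>curl v = - \<kappa> \<alpha> v\<close> with
  \<open>\<kappa> = sqrt 3\<close> for the first and \<open>\<kappa> = - sqrt 3\<close> for the second family (\<open>curl_v0\<close>). Hence the convective
  field is the gradient of \<open>\<bar>v\<bar>\<^sup>2 / 2\<close>. This gives pressure integrability, and it gives the reduction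
  condition because the derivative in direction \<open>i\<close> of a periodic function has no
  \<open>x\<^sub>i\<close>-independent part. The helicity is \<open>- \<kappa> \<alpha>\<close> times the integral of
  \<open>\<bar>v\<bar>\<^sup>2\<close>, which the eight-point mean evaluates (\<open>helicity_beltrami\<close>).

  Conversely, put \<open>p = \<xi>\<^sub>2 - \<xi>\<^sub>1\<close> and \<open>q = \<xi>\<^sub>3 - \<xi>\<^sub>1\<close>. The mean of the first convective component over
  \<open>x\<^sub>1\<close> is a harmonic in \<open>x\<^sub>2\<close> plus a harmonic in \<open>x\<^sub>3\<close>, and their vanishing yields three equations
  in \<open>p\<close> and \<open>q\<close> (\<open>phase_equations\<close>). Their solutions are the two families and the degenerate case
  \<open>sin p = 0 = cos q\<close>, in which the two products making up each component cancel
  (\<open>phase_solutions\<close>).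

  A translation or proper rotation carries the curl of a field to the curl of its image
  (\<open>curl_carries\<close>), so it preserves curl eigenvalues. The two families have opposite nonzero
  eigenvalues and their fields do not vanish, so no such motion relates them. This pointwise argument
  replaces a comparison of helicities, for which the cell of periods is awkward because rotations
  need not preserve it.
\<close>

section \<open>Integration of Fourier modes over the cell\<close>

text \<open>Lebesgue measure on \<open>real ^ 'n\<close> is the image of a finite product measure, which turns
  integrals of separated functions into products of one-dimensional integrals.\<close>
lemma product_function_integral:
  fixes f :: "'n::finite \<Rightarrow> real \<Rightarrow> complex"
  assumes int: "\<And>i. integrable lborel (f i)"
  shows "integrable lborel (\<lambda>x::real^'n. \<Prod>i\<in>UNIV. f i (x $ i))"
    and "(\<integral>x. (\<Prod>i\<in>UNIV. f i ((x::real^'n) $ i)) \<partial>lborel) = (\<Prod>i\<in>UNIV. \<integral>t. f i t \<partial>lborel)"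
proof -
  interpret product_sigma_finite "\<lambda>_::real^'n. lborel :: real measure" by standard
  define e :: "'n \<Rightarrow> real^'n" where "e i = axis i 1" for i
  define g where "g b = f (inv e b)" for b
  define T where "T = (\<lambda>u::real^'n \<Rightarrow> real. \<Sum>b\<in>Basis. u b *\<^sub>R b)"
  have inj: "inj e" by (auto simp: inj_on_def e_def axis_eq_axis)
  have Basis: "Basis = range e" by (auto simp: Basis_vec_def e_def)
  have comp: "T u $ i = u (e i)" for u i
  proof -
    have "T u $ i = (\<Sum>j\<in>UNIV. u (e j) * e j $ i)"
      by (simp add: T_def Basis sum.reindex[OF inj])
    also have "\<dots> = (\<Sum>j\<in>UNIV. if j = i then u (e j) else 0)"
      by (intro sum.cong) (auto simp: e_def axis_def)
    finally show ?thesis by simp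
  qed
  have reindex: "(\<Prod>b\<in>Basis. F b) = (\<Prod>i\<in>UNIV. F (e i))" for F :: "real^'n \<Rightarrow> complex"
    by (simp add: Basis prod.reindex[OF inj])
  have g_e: "g (e i) = f i" for i by (simp add: g_def inj)
  have meas: "(\<lambda>x::real^'n. \<Prod>i\<in>UNIV. f i (x $ i)) \<in> borel_measurable borel"
  proof (intro borel_measurable_prod)
    fix i
    have "f i \<in> borel_measurable borel" using int[of i] by (auto dest: borel_measurable_integrable)
    then show "(\<lambda>x::real^'n. f i (x $ i)) \<in> borel_measurable borel"
      by (intro measurable_compose[of "\<lambda>x. x $ i" borel borel "f i"])
         (auto intro!: borel_measurable_continuous_onI continuous_intros)
  qed
  have lborel: "(lborel :: (real^'n) measure) = distr (\<Pi>\<^sub>M b\<in>Basis. lborel) borel T"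
    unfolding T_def by (rule lborel_eq)
  have T: "T \<in> measurable (\<Pi>\<^sub>M b\<in>Basis. lborel) borel"
    unfolding T_def by measurable
  have int': "integrable lborel (g b)" for b
    unfolding g_def by (rule int)
  have pull: "(\<Prod>i\<in>UNIV. f i (T u $ i)) = (\<Prod>b\<in>Basis. g b (u b))" for u
    by (simp add: comp reindex g_e)
  show "integrable lborel (\<lambda>x::real^'n. \<Prod>i\<in>UNIV. f i (x $ i))"
    unfolding lborel
    by (subst integrable_distr_eq[OF T meas], unfold pull)
       (intro product_integrable_prod int' finite_Basis)
  have "(\<integral>x. (\<Prod>i\<in>UNIV. f i ((x::real^'n) $ i)) \<partial>lborel)
      = (\<integral>u. (\<Prod>b\<in>Basis. g b (u b)) \<partial>(\<Pi>\<^sub>M b\<in>Basis. lborel))"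
    unfolding lborel
    by (subst integral_distr[OF T meas], unfold pull) simp
  also have "\<dots> = (\<Prod>b\<in>Basis. \<integral>t. g b t \<partial>lborel)"
    by (intro product_integral_prod int' finite_Basis)
  finally show "(\<integral>x. (\<Prod>i\<in>UNIV. f i ((x::real^'n) $ i)) \<partial>lborel) = (\<Prod>i\<in>UNIV. \<integral>t. f i t \<partial>lborel)"
    by (simp add: reindex g_e)
qed

lemma period_integral_cis:
  fixes \<alpha> :: real and m :: int
  assumes "\<alpha> > 0"
  shows "integrable lborel (\<lambda>t. indicator {0..<2*pi/\<alpha>} t *\<^sub>R cis (\<alpha> * of_int m * t))"
    and "(\<integral>t. indicator {0..<2*pi/\<alpha>} t *\<^sub>R cis (\<alpha> * of_int m * t) \<partial>lborel)
         = (if m = 0 then complex_of_real (2*pi/\<alpha>) else 0)"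
proof -
  define L where "L = 2*pi/\<alpha>"
  have L: "0 \<le> L" using assms by (simp add: L_def)
  let ?f = "\<lambda>t::real. cis (\<alpha> * of_int m * t)"
  have cont: "continuous_on UNIV ?f" by (intro continuous_intros)
  have eq: "AE t in lborel. indicator {0..<L} t *\<^sub>R ?f t = indicator {0..L} t *\<^sub>R ?f t"
    using AE_lborel_singleton[of L] by eventually_elim (auto simp: indicator_def)
  have int: "integrable lborel (\<lambda>t. indicator {0..L} t *\<^sub>R ?f t)"
    by (rule borel_integrable_compact) (auto intro: continuous_on_subset[OF cont])
  have meas: "(\<lambda>t. indicator {0..<L} t *\<^sub>R ?f t) \<in> borel_measurable lborel"
    using borel_measurable_continuous_onI[OF cont] by measurable
  show "integrable lborel (\<lambda>t. indicator {0..<2*pi/\<alpha>} t *\<^sub>R ?f t)"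
    using integrable_cong_AE[OF meas borel_measurable_integrable[OF int] eq] int by (simp add: L_def)
  have "(\<integral>t. indicator {0..<L} t *\<^sub>R ?f t \<partial>lborel) = (\<integral>t. indicator {0..L} t *\<^sub>R ?f t \<partial>lborel)"
    by (rule integral_cong_AE[OF meas borel_measurable_integrable[OF int] eq])
  also have "\<dots> = (if m = 0 then complex_of_real L else 0)"
  proof (cases "m = 0")
    case True
    have "(\<integral>t. indicator {0..L} t *\<^sub>R (1::complex) \<partial>lborel) = of_real L - of_real 0"
      by (rule integral_FTC_Icc) (auto intro!: derivative_eq_intros L continuous_intros)
    then show ?thesis using True by (simp add: cis_zero)
  next
    case False
    define w where "w = \<alpha> * of_int m"
    have w: "w \<noteq> 0" using False assms by (simp add: w_def)
    have "(\<integral>t. indicator {0..L} t *\<^sub>R ?f t \<partial>lborel)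
        = cis (w * L) / (\<i> * w) - cis (w * 0) / (\<i> * w)"
    proof (rule integral_FTC_Icc[OF L])
      fix t
      have "((\<lambda>z. exp (\<i> * w * z) / (\<i> * w)) has_field_derivative exp (\<i> * w * of_real t)) (at (of_real t))"
        using w by (auto intro!: derivative_eq_intros)
      from has_vector_derivative_real_field[OF this]
      show "((\<lambda>t. cis (w * t) / (\<i> * w)) has_vector_derivative ?f t) (at t within {0..L})"
        by (simp add: cis_conv_exp w_def mult_ac)
    qed (intro continuous_intros)
    also have "w * L = 2 * pi * of_int m" using assms by (simp add: w_def L_def)
    also have "cis (2 * pi * of_int m) = 1" by (rule cis_multiple_2pi) simp
    finally show ?thesis using False by simp
  qed
  finally show "(\<integral>t. indicator {0..<2*pi/\<alpha>} t *\<^sub>R ?f t \<partial>lborel) = (if m = 0 then complex_of_real (2*pi/\<alpha>) else 0)"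
    by (simp add: L_def)
qed

lemma prod_3: "prod f (UNIV :: 3 set) = f 1 * f 2 * f 3"
  unfolding UNIV_3 by (simp add: ac_simps)

lemma fourier_mode_prod: "fourier_mode \<alpha> k x = (\<Prod>i\<in>UNIV. cis (\<alpha> * of_int (k $ i) * x $ i))"
  by (simp add: fourier_mode_def prod_3 sum_3 cis_mult distrib_left mult.assoc)

lemma cell_integral_mode:
  assumes "\<alpha> > 0"
  shows "set_integrable lborel (cell \<alpha>) (fourier_mode \<alpha> k)"
    and "(LINT x:cell \<alpha>|lborel. fourier_mode \<alpha> k x) = (if k = 0 then complex_of_real ((2*pi/\<alpha>)^3) else 0)"
proof -
  define F where "F i t = indicator {0..<2*pi/\<alpha>} t *\<^sub>R cis (\<alpha> * of_int (k $ i) * t)" for i t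
  have cell: "indicator (cell \<alpha>) x = (\<Prod>i\<in>UNIV. indicator {0..<2*pi/\<alpha>} (x $ i) :: real)" for x
    by (auto simp: indicator_def cell_def)
  have split: "indicator (cell \<alpha>) x *\<^sub>R fourier_mode \<alpha> k x = (\<Prod>i\<in>UNIV. F i (x $ i))" for x
    unfolding cell fourier_mode_prod F_def by (simp add: scaleR_conv_of_real prod.distrib)
  have intF: "integrable lborel (F i)" for i
    unfolding F_def by (rule period_integral_cis(1)[OF assms])
  have val: "integral\<^sup>L lborel (F i) = (if k $ i = 0 then complex_of_real (2*pi/\<alpha>) else 0)" for i
    unfolding F_def by (rule period_integral_cis(2)[OF assms])
  show "set_integrable lborel (cell \<alpha>) (fourier_mode \<alpha> k)"
    unfolding set_integrable_def split by (rule product_function_integral(1)) (rule intF)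
  have "(LINT x:cell \<alpha>|lborel. fourier_mode \<alpha> k x) = (\<Prod>i\<in>UNIV. integral\<^sup>L lborel (F i))"
    unfolding set_lebesgue_integral_def split by (rule product_function_integral(2)) (rule intF)
  then show "(LINT x:cell \<alpha>|lborel. fourier_mode \<alpha> k x) = (if k = 0 then complex_of_real ((2*pi/\<alpha>)^3) else 0)"
    by (simp add: val prod_3 vec_eq_iff forall_3 power3_eq_cube)
qed

section \<open>Trigonometric polynomials and quarter-period averages\<close>

lemma fourier_mode_add: "fourier_mode \<alpha> (k + l) x = fourier_mode \<alpha> k x * fourier_mode \<alpha> l x"
  by (simp add: fourier_mode_def cis_mult sum_3 algebra_simps)

lemma fourier_mode_cnj: "cnj (fourier_mode \<alpha> k x) = fourier_mode \<alpha> (- k) x"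
  by (simp add: fourier_mode_def cis_cnj sum_negf)

text \<open>Trigonometric polynomials with frequencies in \<open>S\<close>. The induction rule reduces every linear
  statement about them to a single mode.\<close>
inductive trig :: "real \<Rightarrow> (int ^ 3) set \<Rightarrow> (real ^ 3 \<Rightarrow> complex) \<Rightarrow> bool" for \<alpha> S where
  mode: "k \<in> S \<Longrightarrow> trig \<alpha> S (\<lambda>x. c * fourier_mode \<alpha> k x)"
| add: "trig \<alpha> S f \<Longrightarrow> trig \<alpha> S g \<Longrightarrow> trig \<alpha> S (\<lambda>x. f x + g x)"

lemma trig_scale:
  assumes "trig \<alpha> S f" shows "trig \<alpha> S (\<lambda>x. c * f x)"
  using assms
proof induction
  case (mode k d)
  have "trig \<alpha> S (\<lambda>x. (c * d) * fourier_mode \<alpha> k x)" using mode by (rule trig.mode)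
  then show ?case by (simp add: mult.assoc)
next
  case (add f g)
  then have "trig \<alpha> S (\<lambda>x. c * f x + c * g x)" by (intro trig.add)
  then show ?case by (simp add: distrib_left)
qed

lemma trig_mult:
  assumes f: "trig \<alpha> S f" and g: "trig \<alpha> T g" and U: "\<And>k l. k \<in> S \<Longrightarrow> l \<in> T \<Longrightarrow> k + l \<in> U"
  shows "trig \<alpha> U (\<lambda>x. f x * g x)"
  using f
proof induction
  case (mode k c)
  show ?case using g
  proof induction
    case (mode l d)
    have "trig \<alpha> U (\<lambda>x. (c * d) * fourier_mode \<alpha> (k + l) x)"
      using U \<open>k \<in> S\<close> mode by (intro trig.mode)
    then show ?case by (simp add: fourier_mode_add mult_ac)
  next
    case (add g1 g2)
    then have "trig \<alpha> U (\<lambda>x. c * fourier_mode \<alpha> k x * g1 x + c * fourier_mode \<alpha> k x * g2 x)"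
      by (intro trig.add)
    then show ?case by (simp add: distrib_left)
  qed
next
  case (add f1 f2)
  then have "trig \<alpha> U (\<lambda>x. f1 x * g x + f2 x * g x)" by (intro trig.add)
  then show ?case by (simp add: distrib_right)
qed

lemma trig_cos:
  assumes "axis i 1 \<in> S" "- axis i 1 \<in> S"
  shows "trig \<alpha> S (\<lambda>x. complex_of_real (cos (\<alpha> * x $ i + \<phi>)))"
proof -
  have m: "fourier_mode \<alpha> (axis i 1) x = cis (\<alpha> * x $ i)"
    "fourier_mode \<alpha> (- axis i 1) x = cis (- (\<alpha> * x $ i))" for x
    using exhaust_3[of i] by (auto simp: fourier_mode_def sum_3 axis_def)
  have "trig \<alpha> S (\<lambda>x. (cis \<phi> / 2) * fourier_mode \<alpha> (axis i 1) x + (cis (-\<phi>) / 2) * fourier_mode \<alpha> (- axis i 1) x)"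
    using assms by (intro trig.add trig.mode)
  moreover have "(cis \<phi> / 2) * cis u + (cis (-\<phi>) / 2) * cis (- u) = complex_of_real (cos (u + \<phi>))" for u
    by (simp add: complex_eq_iff cos_add sin_add field_simps)
  ultimately show ?thesis by (simp add: m)
qed

lemma trig_sin:
  assumes "axis i 1 \<in> S" "- axis i 1 \<in> S"
  shows "trig \<alpha> S (\<lambda>x. complex_of_real (sin (\<alpha> * x $ i + \<phi>)))"
  using trig_cos[OF assms, of \<alpha> "\<phi> - pi/2"] by (simp add: cos_diff cos_add sin_add sin_diff algebra_simps)

text \<open>Each component of the field has degree exactly one in each coordinate, so products of two
  components carry only the frequencies \<open>0\<close> and \<open>\<plusminus>2\<close> in each. A shift by a quarter period
  \<open>\<pi> / (2 \<alpha>)\<close> multiplies these by \<open>1\<close> and \<open>-1\<close>, so the mean of two points replaces integration.\<close>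
definition odd_freqs :: "(int ^ 3) set" where "odd_freqs = {k. \<forall>i. k $ i \<in> {-1, 1}}"
definition even_freqs :: "(int ^ 3) set" where "even_freqs = {k. \<forall>i. k $ i \<in> {-2, 0, 2}}"

lemma trig_product:
  assumes "\<And>S. axis 1 1 \<in> S \<Longrightarrow> - axis 1 1 \<in> S \<Longrightarrow> trig \<alpha> S f"
    and "\<And>S. axis 2 1 \<in> S \<Longrightarrow> - axis 2 1 \<in> S \<Longrightarrow> trig \<alpha> S g"
    and "\<And>S. axis 3 1 \<in> S \<Longrightarrow> - axis 3 1 \<in> S \<Longrightarrow> trig \<alpha> S h"
  shows "trig \<alpha> odd_freqs (\<lambda>x. f x * g x * h x)"
proof -
  have "trig \<alpha> {k. k $ 1 \<in> {-1,1} \<and> k $ 2 \<in> {-1,1} \<and> k $ 3 = 0} (\<lambda>x. f x * g x)"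
    by (rule trig_mult[of _ "{axis 1 1, - axis 1 1}" _ "{axis 2 1, - axis 2 1}", OF assms(1,2)])
       (auto simp: axis_def)
  then show ?thesis
    by (rule trig_mult[of _ _ _ "{axis 3 1, - axis 3 1}", OF _ assms(3)])
       (auto simp: axis_def odd_freqs_def forall_3)
qed

lemma trig_even:
  assumes "trig \<alpha> odd_freqs f" "trig \<alpha> odd_freqs g"
  shows "trig \<alpha> even_freqs (\<lambda>x. f x * g x)"
  by (rule trig_mult[OF assms]) (auto simp: odd_freqs_def even_freqs_def forall_3)

definition quarter :: "real \<Rightarrow> 3 \<Rightarrow> real ^ 3 \<Rightarrow> real ^ 3" where
  "quarter \<alpha> i x = x + (pi / (2 * \<alpha>)) *\<^sub>R axis i 1"

lemma quarter_nth: "quarter \<alpha> j x $ k = x $ k + (if k = j then pi / (2 * \<alpha>) else 0)"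
  by (simp add: quarter_def axis_def)

lemma fourier_mode_quarter:
  assumes "\<alpha> > 0"
  shows "fourier_mode \<alpha> k (quarter \<alpha> i x) = cis (of_int (k $ i) * pi / 2) * fourier_mode \<alpha> k x"
proof -
  have "\<alpha> * (\<Sum>j\<in>UNIV. of_int (k $ j) * quarter \<alpha> i x $ j)
      = of_int (k $ i) * pi / 2 + \<alpha> * (\<Sum>j\<in>UNIV. of_int (k $ j) * x $ j)"
    using assms exhaust_3[of i] by (auto simp: quarter_nth sum_3 field_simps)
  then show ?thesis
    by (simp only: fourier_mode_def cis_mult)
qed

text \<open>Twice the projection onto the modes with \<open>k\<^sub>i = 0\<close>, when only even frequencies occur.\<close>
definition pair_sum :: "real \<Rightarrow> 3 \<Rightarrow> (real ^ 3 \<Rightarrow> 'a::real_vector) \<Rightarrow> real ^ 3 \<Rightarrow> 'a" where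
  "pair_sum \<alpha> i f x = f x + f (quarter \<alpha> i x)"

lemma pair_sum_mode:
  assumes "\<alpha> > 0" "k \<in> even_freqs"
  shows "pair_sum \<alpha> i (\<lambda>x. (c::complex) * fourier_mode \<alpha> k x) =
    (\<lambda>x. (if k $ i = 0 then 2 * c else 0) * fourier_mode \<alpha> k x)"
proof -
  have "k $ i \<in> {-2,0,2}" using assms(2) by (auto simp: even_freqs_def)
  moreover have "cis (- pi) = -1" by (simp add: complex_eq_iff)
  ultimately show ?thesis
    by (auto simp: pair_sum_def fourier_mode_quarter[OF assms(1)] fun_eq_iff)
qed

lemma pair_sum_add: "pair_sum \<alpha> i (\<lambda>x. f x + g x) = (\<lambda>x. pair_sum \<alpha> i f x + pair_sum \<alpha> i g x)"
  by (simp add: pair_sum_def fun_eq_iff)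

lemma trig_set_integrable:
  assumes "\<alpha> > 0" "trig \<alpha> S f"
  shows "set_integrable lborel (cell \<alpha>) (\<lambda>x. f x * cnj (fourier_mode \<alpha> l x))"
  using assms(2)
proof induction
  case (mode k c)
  have "set_integrable lborel (cell \<alpha>) (\<lambda>x. c * fourier_mode \<alpha> (k - l) x)"
    by (intro set_integrable_mult_right cell_integral_mode(1)[OF assms(1)])
  then show ?case
    by (simp add: fourier_mode_cnj fourier_mode_add[symmetric] mult.assoc)
next
  case (add f g)
  then show ?case by (simp add: distrib_right set_integral_add)
qed

text \<open>The Fourier coefficient for complex-valued functions: single modes are not real, and the
  induction over trigonometric polynomials passes through them.\<close>
definition complex_fourier_coeff :: "real \<Rightarrow> (real ^ 3 \<Rightarrow> complex) \<Rightarrow> int ^ 3 \<Rightarrow> complex" where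
  "complex_fourier_coeff \<alpha> f k = complex_of_real ((\<alpha> / (2 * pi)) ^ 3) *
       (LINT x:cell \<alpha>|lborel. f x * cnj (fourier_mode \<alpha> k x))"

lemma complex_fourier_coeff_mode:
  assumes "\<alpha> > 0"
  shows "complex_fourier_coeff \<alpha> (\<lambda>x. c * fourier_mode \<alpha> k x) l = (if l = k then c else 0)"
proof -
  have "(LINT x:cell \<alpha>|lborel. c * fourier_mode \<alpha> k x * cnj (fourier_mode \<alpha> l x))
      = c * (LINT x:cell \<alpha>|lborel. fourier_mode \<alpha> (k - l) x)"
    by (simp add: fourier_mode_cnj fourier_mode_add[symmetric] mult.assoc)
  also have "\<dots> = (if l = k then c * complex_of_real ((2*pi/\<alpha>)^3) else 0)"
    by (simp add: cell_integral_mode(2)[OF assms])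
  finally show ?thesis
    using assms by (auto simp: complex_fourier_coeff_def power_divide)
qed

lemma has_sum_independent_modes:
  assumes "\<alpha> > 0" "trig \<alpha> even_freqs f"
  shows "((\<lambda>k. complex_fourier_coeff \<alpha> f k * fourier_mode \<alpha> k x) has_sum (pair_sum \<alpha> i f x / 2))
           {k. k $ i = 0}"
  using assms(2)
proof induction
  case (mode k c)
  have "((\<lambda>l. if l = k then c * fourier_mode \<alpha> k x else 0) has_sum
      (if k $ i = 0 then c * fourier_mode \<alpha> k x else 0)) {l. l $ i = 0}"
    by (rule has_sum_finite_neutralI[of "{k} \<inter> {l. l $ i = 0}"]) auto
  moreover have "(\<lambda>l. if l = k then c * fourier_mode \<alpha> k x else 0)
      = (\<lambda>l. complex_fourier_coeff \<alpha> (\<lambda>x. c * fourier_mode \<alpha> k x) l * fourier_mode \<alpha> l x)"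
    by (auto simp: complex_fourier_coeff_mode[OF assms(1)])
  ultimately show ?case
    by (simp add: pair_sum_mode[OF assms(1) mode] split: if_splits)
next
  case (add f g)
  have "complex_fourier_coeff \<alpha> (\<lambda>x. f x + g x) k =
      complex_fourier_coeff \<alpha> f k + complex_fourier_coeff \<alpha> g k" for k
    using trig_set_integrable[OF assms(1)] add.hyps
    by (simp add: complex_fourier_coeff_def distrib_right set_integral_add(2) algebra_simps)
  then show ?case
    using has_sum_add[OF add.IH] by (simp add: pair_sum_add distrib_right add_divide_distrib)
qed

lemma independent_part_eq:
  assumes "\<alpha> > 0" "trig \<alpha> even_freqs (\<lambda>x. complex_of_real (f x))"
  shows "independent_part \<alpha> i f x = complex_of_real ((f x + f (quarter \<alpha> i x)) / 2)"
  using infsumI[OF has_sum_independent_modes[OF assms]]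
  by (simp add: independent_part_def fourier_coeff_def complex_fourier_coeff_def pair_sum_def)

text \<open>The three projections together leave only the constant mode, so the eight-point sum does not
  depend on the base point \<open>x\<close>.\<close>
lemma cell_integral_eq:
  assumes "\<alpha> > 0" "trig \<alpha> even_freqs f"
  shows "(LINT x:cell \<alpha>|lborel. f x) =
    complex_of_real ((2*pi/\<alpha>)^3 / 8) * pair_sum \<alpha> 1 (pair_sum \<alpha> 2 (pair_sum \<alpha> 3 f)) x"
  using assms(2)
proof induction
  case (mode k c)
  have "pair_sum \<alpha> 1 (pair_sum \<alpha> 2 (pair_sum \<alpha> 3 (\<lambda>x. c * fourier_mode \<alpha> k x)))
      = (\<lambda>x. (if k = 0 then 8 * c else 0) * fourier_mode \<alpha> k x)"
    by (simp only: pair_sum_mode[OF assms(1) mode]) (simp add: vec_eq_iff forall_3 fun_eq_iff)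
  then show ?case
    by (simp add: cell_integral_mode(2)[OF assms(1)]) (simp add: fourier_mode_def)
next
  case (add f g)
  have "set_integrable lborel (cell \<alpha>) f" "set_integrable lborel (cell \<alpha>) g"
    using trig_set_integrable[OF assms(1), of even_freqs _ 0] add.hyps
    by (force simp: fourier_mode_def)+
  then show ?case by (simp only: set_integral_add(2) add.IH pair_sum_add distrib_left)
qed

lemma cell_integral_eq_real:
  fixes f :: "real ^ 3 \<Rightarrow> real"
  assumes "\<alpha> > 0" "trig \<alpha> even_freqs (\<lambda>x. complex_of_real (f x))"
  shows "(LINT x:cell \<alpha>|lborel. f x) = (2*pi/\<alpha>)^3 / 8 * pair_sum \<alpha> 1 (pair_sum \<alpha> 2 (pair_sum \<alpha> 3 f)) x"
proof -
  have "complex_of_real (LINT x:cell \<alpha>|lborel. f x) = (LINT x:cell \<alpha>|lborel. complex_of_real (f x))"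
    by (rule set_integral_complex_of_real[symmetric])
  also have "\<dots> = complex_of_real ((2*pi/\<alpha>)^3 / 8 * pair_sum \<alpha> 1 (pair_sum \<alpha> 2 (pair_sum \<alpha> 3 f)) x)"
    unfolding cell_integral_eq[OF assms, of x] by (simp add: pair_sum_def)
  finally show ?thesis by (simp only: of_real_eq_iff)
qed

section \<open>The field and its convective term\<close>

lemma sin_quarter: "\<alpha> \<noteq> 0 \<Longrightarrow> sin (\<alpha> * (y + pi / (2 * \<alpha>)) + \<phi>) = cos (\<alpha> * y + \<phi>)"
  and cos_quarter: "\<alpha> \<noteq> 0 \<Longrightarrow> cos (\<alpha> * (y + pi / (2 * \<alpha>)) + \<phi>) = - sin (\<alpha> * y + \<phi>)"
proof -
  assume "\<alpha> \<noteq> 0"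
  then have *: "\<alpha> * (y + pi / (2 * \<alpha>)) + \<phi> = (\<alpha> * y + \<phi>) + pi / 2" by (simp add: field_simps)
  show "sin (\<alpha> * (y + pi / (2 * \<alpha>)) + \<phi>) = cos (\<alpha> * y + \<phi>)"
    "cos (\<alpha> * (y + pi / (2 * \<alpha>)) + \<phi>) = - sin (\<alpha> * y + \<phi>)"
    unfolding * by (simp_all add: sin_add cos_add)
qed

lemma v0_component:
  "v0 \<alpha> vr \<xi> x $ 1 = vr *
     (sin (\<alpha> * x $ 1 + \<xi> $ 1) * cos (\<alpha> * x $ 2 + \<xi> $ 2) * sin (\<alpha> * x $ 3 + \<xi> $ 3)
      - sin (\<alpha> * x $ 1 + \<xi> $ 2) * sin (\<alpha> * x $ 2 + \<xi> $ 3) * cos (\<alpha> * x $ 3 + \<xi> $ 1))"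
  "v0 \<alpha> vr \<xi> x $ 2 = vr *
     (sin (\<alpha> * x $ 2 + \<xi> $ 1) * cos (\<alpha> * x $ 3 + \<xi> $ 2) * sin (\<alpha> * x $ 1 + \<xi> $ 3)
      - sin (\<alpha> * x $ 2 + \<xi> $ 2) * sin (\<alpha> * x $ 3 + \<xi> $ 3) * cos (\<alpha> * x $ 1 + \<xi> $ 1))"
  "v0 \<alpha> vr \<xi> x $ 3 = vr *
     (sin (\<alpha> * x $ 3 + \<xi> $ 1) * cos (\<alpha> * x $ 1 + \<xi> $ 2) * sin (\<alpha> * x $ 2 + \<xi> $ 3)
      - sin (\<alpha> * x $ 3 + \<xi> $ 2) * sin (\<alpha> * x $ 1 + \<xi> $ 3) * cos (\<alpha> * x $ 2 + \<xi> $ 1))"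
  by (simp_all add: v0_def v1_def)

lemma trig_v0: "trig \<alpha> odd_freqs (\<lambda>x. complex_of_real (v0 \<alpha> vr \<xi> x $ i))"
proof -
  have comb: "trig \<alpha> odd_freqs (\<lambda>x. complex_of_real (vr * (f x * g x * h x - f' x * g' x * h' x)))"
    if "trig \<alpha> odd_freqs (\<lambda>x. complex_of_real (f x) * complex_of_real (g x) * complex_of_real (h x))"
      "trig \<alpha> odd_freqs (\<lambda>x. complex_of_real (f' x) * complex_of_real (g' x) * complex_of_real (h' x))"
    for f g h f' g' h'
    using trig.add[OF trig_scale[OF that(1), of "complex_of_real vr"] trig_scale[OF that(2), of "complex_of_real (-vr)"]]
    by (simp add: algebra_simps)
  note sc = trig_sin trig_cos
  consider "i = 1" | "i = 2" | "i = 3" using exhaust_3 by blast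
  then show ?thesis
  proof cases
    case 1
    have "trig \<alpha> odd_freqs (\<lambda>x. complex_of_real (vr *
       (sin (\<alpha> * x $ 1 + \<xi> $ 1) * cos (\<alpha> * x $ 2 + \<xi> $ 2) * sin (\<alpha> * x $ 3 + \<xi> $ 3)
        - sin (\<alpha> * x $ 1 + \<xi> $ 2) * sin (\<alpha> * x $ 2 + \<xi> $ 3) * cos (\<alpha> * x $ 3 + \<xi> $ 1))))"
      by (intro comb trig_product sc)
    then show ?thesis by (simp add: 1 v0_component)
  next
    case 2
    have "trig \<alpha> odd_freqs (\<lambda>x. complex_of_real (vr *
       (sin (\<alpha> * x $ 1 + \<xi> $ 3) * sin (\<alpha> * x $ 2 + \<xi> $ 1) * cos (\<alpha> * x $ 3 + \<xi> $ 2)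
        - cos (\<alpha> * x $ 1 + \<xi> $ 1) * sin (\<alpha> * x $ 2 + \<xi> $ 2) * sin (\<alpha> * x $ 3 + \<xi> $ 3))))"
      by (intro comb trig_product sc)
    then show ?thesis by (simp add: 2 v0_component mult_ac)
  next
    case 3
    have "trig \<alpha> odd_freqs (\<lambda>x. complex_of_real (vr *
       (cos (\<alpha> * x $ 1 + \<xi> $ 2) * sin (\<alpha> * x $ 2 + \<xi> $ 3) * sin (\<alpha> * x $ 3 + \<xi> $ 1)
        - sin (\<alpha> * x $ 1 + \<xi> $ 3) * cos (\<alpha> * x $ 2 + \<xi> $ 1) * sin (\<alpha> * x $ 3 + \<xi> $ 2))))"
      by (intro comb trig_product sc)
    then show ?thesis by (simp add: 3 v0_component mult_ac)
  qed
qed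

text \<open>Degree one in each coordinate makes differentiation a quarter-period shift up to the factor
  \<open>\<alpha>\<close>. All partial derivatives below are therefore values of the field itself at shifted points.\<close>
lemma v0_directional_deriv:
  assumes "\<alpha> > 0"
  shows "((\<lambda>t. v0 \<alpha> vr \<xi> (x + t *\<^sub>R axis j 1) $ i) has_real_derivative
           \<alpha> * v0 \<alpha> vr \<xi> (quarter \<alpha> j (x + t *\<^sub>R axis j 1)) $ i) (at t)"
  using exhaust_3[of i] exhaust_3[of j] assms
  by (elim disjE; simp only: v0_component quarter_nth vector_add_component vector_scaleR_component;
      simp add: axis_def sin_quarter cos_quarter;
      auto intro!: derivative_eq_intros simp: algebra_simps)

lemma pd_v0:
  assumes "\<alpha> > 0"
  shows "pd j (\<lambda>y. v0 \<alpha> vr \<xi> y $ i) x = \<alpha> * v0 \<alpha> vr \<xi> (quarter \<alpha> j x) $ i"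
  unfolding pd_def using DERIV_imp_deriv[OF v0_directional_deriv[OF assms, of vr \<xi> x j i 0]] by simp

lemma v0_half_period:
  assumes "\<alpha> > 0"
  shows "v0 \<alpha> vr \<xi> (quarter \<alpha> j (quarter \<alpha> j x)) $ i = - v0 \<alpha> vr \<xi> x $ i"
  using exhaust_3[of i] exhaust_3[of j] assms
  by (elim disjE; simp add: v0_component quarter_nth sin_quarter cos_quarter; simp add: algebra_simps)

lemma quarter_commute: "quarter \<alpha> i (quarter \<alpha> j x) = quarter \<alpha> j (quarter \<alpha> i x)"
  by (simp add: quarter_def)

lemma convective_v0:
  assumes "\<alpha> > 0"
  shows "convective (v0 \<alpha> vr \<xi>) i x =
    (\<Sum>j\<in>UNIV. v0 \<alpha> vr \<xi> x $ j * (\<alpha> * v0 \<alpha> vr \<xi> (quarter \<alpha> j x) $ i))"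
  by (simp add: convective_def pd_v0[OF assms])

lemma trig_quarter:
  assumes "\<alpha> > 0" "trig \<alpha> S f"
  shows "trig \<alpha> S (\<lambda>x. f (quarter \<alpha> i x))"
  using assms(2)
proof induction
  case (mode k c)
  have "trig \<alpha> S (\<lambda>x. (c * cis (of_int (k $ i) * pi / 2)) * fourier_mode \<alpha> k x)"
    using mode by (rule trig.mode)
  then show ?case by (simp add: fourier_mode_quarter[OF assms(1)] mult.assoc)
next
  case (add f g)
  then show ?case by (intro trig.add)
qed

lemma trig_convective:
  assumes "\<alpha> > 0"
  shows "trig \<alpha> even_freqs (\<lambda>x. complex_of_real (convective (v0 \<alpha> vr \<xi>) i x))"
proof -
  have "trig \<alpha> even_freqs (\<lambda>x. complex_of_real (v0 \<alpha> vr \<xi> x $ j) *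
      (complex_of_real \<alpha> * complex_of_real (v0 \<alpha> vr \<xi> (quarter \<alpha> j x) $ i)))" for j
    by (intro trig_even trig_scale trig_v0 trig_quarter[OF assms, of _ "\<lambda>x. complex_of_real (v0 \<alpha> vr \<xi> x $ i)"])
  then have "trig \<alpha> even_freqs (\<lambda>x.
      complex_of_real (v0 \<alpha> vr \<xi> x $ 1) * (complex_of_real \<alpha> * complex_of_real (v0 \<alpha> vr \<xi> (quarter \<alpha> 1 x) $ i))
    + complex_of_real (v0 \<alpha> vr \<xi> x $ 2) * (complex_of_real \<alpha> * complex_of_real (v0 \<alpha> vr \<xi> (quarter \<alpha> 2 x) $ i))
    + complex_of_real (v0 \<alpha> vr \<xi> x $ 3) * (complex_of_real \<alpha> * complex_of_real (v0 \<alpha> vr \<xi> (quarter \<alpha> 3 x) $ i)))"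
    by (intro trig.add)
  then show ?thesis by (simp add: convective_v0[OF assms] sum_3)
qed

text \<open>The convective terms have even frequencies, so the vanishing of their \<open>x\<^sub>i\<close>-independent part
  is antisymmetry under the quarter-period shift in direction \<open>i\<close>.\<close>
lemma reduction_condition_v0:
  assumes "\<alpha> > 0"
  shows "reduction_condition \<alpha> (v0 \<alpha> vr \<xi>) \<longleftrightarrow>
    (\<forall>i x. convective (v0 \<alpha> vr \<xi>) i (quarter \<alpha> i x) = - convective (v0 \<alpha> vr \<xi>) i x)"
  unfolding reduction_condition_def independent_part_eq[OF assms trig_convective[OF assms]]
  by (simp add: add_eq_0_iff flip: of_real_add)

section \<open>The two families are Beltrami fields\<close>

text \<open>The trigonometric content of the two families: \<open>\<kappa> = sqrt 3\<close> gives the first and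
  \<open>\<kappa> = - sqrt 3\<close> the second, and the signs \<open>\<sigma>\<close>, \<open>\<tau>\<close> are those produced by the multiples of \<open>\<pi>\<close>.\<close>
definition beltrami_phases :: "real \<Rightarrow> real ^ 3 \<Rightarrow> bool" where
  "beltrami_phases \<kappa> \<xi> \<longleftrightarrow> (\<exists>\<sigma>\<in>{-1, 1}. \<exists>\<tau>\<in>{-1, 1}.
     cos (\<xi> $ 2 - \<xi> $ 1) = - \<sigma> / 2 \<and> sin (\<xi> $ 2 - \<xi> $ 1) = - \<sigma> * \<kappa> / 2 \<and>
     cos (\<xi> $ 3 - \<xi> $ 1) = \<tau> * \<kappa> / 2 \<and> sin (\<xi> $ 3 - \<xi> $ 1) = \<tau> / 2)"

lemma
  shows cos_150: "cos (5 * pi / 6) = - sqrt 3 / 2" and sin_150: "sin (5 * pi / 6) = 1 / 2"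
proof -
  have "5 * pi / 6 = pi - pi / 6" by simp
  then show "cos (5 * pi / 6) = - sqrt 3 / 2" "sin (5 * pi / 6) = 1 / 2"
    by (simp_all only: cos_pi_minus sin_pi_minus cos_30 sin_30)
qed

lemma
  shows sin_add_int_pi: "sin (x + of_int l * pi) = (if even l then 1 else -1) * sin x"
    and cos_add_int_pi: "cos (x + of_int l * pi) = (if even l then 1 else -1) * cos x"
  by (simp_all add: sin_add cos_add mult.commute[of _ pi])

lemma first_family_beltrami:
  assumes "\<xi> \<in> first_family" shows "beltrami_phases (sqrt 3) \<xi>"
proof -
  obtain \<theta> l1 l2 where \<xi>: "\<xi> = vector [\<theta>, \<theta> - 2 * pi / 3 + of_int l1 * pi, \<theta> + pi / 6 + of_int l2 * pi]"
    using assms by (auto simp: first_family_def)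
  have d: "\<xi> $ 2 - \<xi> $ 1 = - (2 * pi / 3) + of_int l1 * pi" "\<xi> $ 3 - \<xi> $ 1 = pi / 6 + of_int l2 * pi"
    by (simp_all add: \<xi>)
  show ?thesis
    unfolding beltrami_phases_def d sin_add_int_pi cos_add_int_pi
    by (rule bexI[of _ "if even l1 then 1 else -1"], rule bexI[of _ "if even l2 then 1 else -1"])
       (auto simp: cos_120 sin_120 cos_30 sin_30)
qed

lemma second_family_beltrami:
  assumes "\<xi> \<in> second_family" shows "beltrami_phases (- sqrt 3) \<xi>"
proof -
  obtain \<theta> l1 l2 where \<xi>: "\<xi> = vector [\<theta>, \<theta> + 2 * pi / 3 + of_int l1 * pi, \<theta> + 5 * pi / 6 + of_int l2 * pi]"
    using assms by (auto simp: second_family_def)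
  have d: "\<xi> $ 2 - \<xi> $ 1 = 2 * pi / 3 + of_int l1 * pi" "\<xi> $ 3 - \<xi> $ 1 = 5 * pi / 6 + of_int l2 * pi"
    by (simp_all add: \<xi>)
  show ?thesis
    unfolding beltrami_phases_def d sin_add_int_pi cos_add_int_pi
    by (rule bexI[of _ "if even l1 then 1 else -1"], rule bexI[of _ "if even l2 then 1 else -1"])
       (auto simp: cos_120 sin_120 cos_150 sin_150)
qed

text \<open>The first component of \<open>curl v = - \<kappa> \<alpha> v\<close>, divided by \<open>\<alpha> vr\<close>; the other components are the
  same identity with permuted coordinates. In terms of the sines and cosines of \<open>y\<^sub>j + \<xi>\<^sub>1\<close> it is a
  polynomial identity modulo \<open>\<kappa>\<^sup>2 = 3\<close>.\<close>
lemma beltrami_identity: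
  fixes y1 y2 y3 :: real
  assumes "\<kappa>\<^sup>2 = 3" "beltrami_phases \<kappa> \<xi>"
  shows "sin (y3 + \<xi> $ 1) * cos (y1 + \<xi> $ 2) * cos (y2 + \<xi> $ 3)
       + sin (y3 + \<xi> $ 2) * sin (y1 + \<xi> $ 3) * sin (y2 + \<xi> $ 1)
       + sin (y2 + \<xi> $ 1) * sin (y3 + \<xi> $ 2) * sin (y1 + \<xi> $ 3)
       + sin (y2 + \<xi> $ 2) * cos (y3 + \<xi> $ 3) * cos (y1 + \<xi> $ 1)
     = - \<kappa> * (sin (y1 + \<xi> $ 1) * cos (y2 + \<xi> $ 2) * sin (y3 + \<xi> $ 3)
             - sin (y1 + \<xi> $ 2) * sin (y2 + \<xi> $ 3) * cos (y3 + \<xi> $ 1))"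
proof -
  obtain \<sigma> \<tau> :: real where p: "cos (\<xi> $ 2 - \<xi> $ 1) = - \<sigma> / 2" "sin (\<xi> $ 2 - \<xi> $ 1) = - \<sigma> * \<kappa> / 2"
    and q: "cos (\<xi> $ 3 - \<xi> $ 1) = \<tau> * \<kappa> / 2" "sin (\<xi> $ 3 - \<xi> $ 1) = \<tau> / 2"
    using assms(2) unfolding beltrami_phases_def by blast
  have shift: "y + \<xi> $ 2 = (y + \<xi> $ 1) + (\<xi> $ 2 - \<xi> $ 1)" "y + \<xi> $ 3 = (y + \<xi> $ 1) + (\<xi> $ 3 - \<xi> $ 1)" for y
    by simp_all
  have p': "sin (y + \<xi> $ 2) = - \<sigma> / 2 * (sin (y + \<xi> $ 1) + \<kappa> * cos (y + \<xi> $ 1))"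
    "cos (y + \<xi> $ 2) = - \<sigma> / 2 * (cos (y + \<xi> $ 1) - \<kappa> * sin (y + \<xi> $ 1))" for y
    unfolding shift(1) sin_add[of "y + \<xi> $ 1"] cos_add[of "y + \<xi> $ 1"] p by (simp_all add: field_simps)
  have q': "sin (y + \<xi> $ 3) = \<tau> / 2 * (\<kappa> * sin (y + \<xi> $ 1) + cos (y + \<xi> $ 1))"
    "cos (y + \<xi> $ 3) = \<tau> / 2 * (\<kappa> * cos (y + \<xi> $ 1) - sin (y + \<xi> $ 1))" for y
    unfolding shift(2) sin_add[of "y + \<xi> $ 1"] cos_add[of "y + \<xi> $ 1"] q by (simp_all add: field_simps)
  define s1 c1 s2 c2 s3 c3 where "s1 = sin (y1 + \<xi> $ 1)" "c1 = cos (y1 + \<xi> $ 1)"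
    "s2 = sin (y2 + \<xi> $ 1)" "c2 = cos (y2 + \<xi> $ 1)" "s3 = sin (y3 + \<xi> $ 1)" "c3 = cos (y3 + \<xi> $ 1)"
  note d = this
  have kk: "\<kappa> * \<kappa> = 3" "\<kappa> * (\<kappa> * z) = 3 * z" for z
    using assms(1) by (simp_all add: power2_eq_square flip: mult.assoc)
  have "s3 * (c1 - \<kappa> * s1) * (\<kappa> * c2 - s2)
       + 2 * ((s3 + \<kappa> * c3) * (\<kappa> * s1 + c1) * s2)
       + (s2 + \<kappa> * c2) * (\<kappa> * c3 - s3) * c1
     = - \<kappa> * (s1 * (c2 - \<kappa> * s2) * (\<kappa> * s3 + c3) - (s1 + \<kappa> * c1) * (\<kappa> * s2 + c2) * c3)"
    by (simp add: kk algebra_simps)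
  then have "(- \<sigma> * \<tau> / 4) * (s3 * (c1 - \<kappa> * s1) * (\<kappa> * c2 - s2)
       + 2 * ((s3 + \<kappa> * c3) * (\<kappa> * s1 + c1) * s2)
       + (s2 + \<kappa> * c2) * (\<kappa> * c3 - s3) * c1)
     = (- \<sigma> * \<tau> / 4) * (- \<kappa> * (s1 * (c2 - \<kappa> * s2) * (\<kappa> * s3 + c3) - (s1 + \<kappa> * c1) * (\<kappa> * s2 + c2) * c3))"
    by (simp only:)
  then show ?thesis
    unfolding p' q' d[symmetric] by (simp add: field_simps)
qed

lemma curl_v0:
  assumes "\<alpha> > 0" "\<kappa>\<^sup>2 = 3" "beltrami_phases \<kappa> \<xi>"
  shows "curl (v0 \<alpha> vr \<xi>) x = (- \<kappa> * \<alpha>) *\<^sub>R v0 \<alpha> vr \<xi> x"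
proof -
  note id = beltrami_identity[OF assms(2,3)]
  have "\<alpha> \<noteq> 0" using assms(1) by simp
  have "curl (v0 \<alpha> vr \<xi>) x $ 1 = (- \<kappa> * \<alpha>) * v0 \<alpha> vr \<xi> x $ 1"
    using arg_cong[OF id[of "\<alpha> * x $ 3" "\<alpha> * x $ 1" "\<alpha> * x $ 2"], of "\<lambda>z. \<alpha> * vr * z"] \<open>\<alpha> \<noteq> 0\<close>
    by (simp add: curl_def pd_v0[OF assms(1)])
       (simp add: v0_component quarter_nth sin_quarter cos_quarter, simp add: algebra_simps)
  moreover have "curl (v0 \<alpha> vr \<xi>) x $ 2 = (- \<kappa> * \<alpha>) * v0 \<alpha> vr \<xi> x $ 2"
    using arg_cong[OF id[of "\<alpha> * x $ 1" "\<alpha> * x $ 2" "\<alpha> * x $ 3"], of "\<lambda>z. \<alpha> * vr * z"] \<open>\<alpha> \<noteq> 0\<close>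
    by (simp add: curl_def pd_v0[OF assms(1)])
       (simp add: v0_component quarter_nth sin_quarter cos_quarter, simp add: algebra_simps)
  moreover have "curl (v0 \<alpha> vr \<xi>) x $ 3 = (- \<kappa> * \<alpha>) * v0 \<alpha> vr \<xi> x $ 3"
    using arg_cong[OF id[of "\<alpha> * x $ 2" "\<alpha> * x $ 3" "\<alpha> * x $ 1"], of "\<lambda>z. \<alpha> * vr * z"] \<open>\<alpha> \<noteq> 0\<close>
    by (simp add: curl_def pd_v0[OF assms(1)])
       (simp add: v0_component quarter_nth sin_quarter cos_quarter, simp add: algebra_simps)
  ultimately show ?thesis by (simp add: vec_eq_iff forall_3)
qed

text \<open>The difference of the two sides is \<open>v \<times> curl v\<close> up to sign, so the convective field of a
  Beltrami field is the gradient of \<open>\<bar>v\<bar>\<^sup>2 / 2\<close>.\<close>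
lemma beltrami_convective:
  assumes "curl v x = c *\<^sub>R v x"
  shows "convective v i x = (\<Sum>j\<in>UNIV. v x $ j * pd i (\<lambda>y. v y $ j) x)"
proof -
  define D where "D j i = pd j (\<lambda>y. v y $ i) x" for j i
  have D: "D 2 3 - D 3 2 = c * v x $ 1" "D 3 1 - D 1 3 = c * v x $ 2" "D 1 2 - D 2 1 = c * v x $ 3"
    using assms by (simp_all add: curl_def vec_eq_iff forall_3 D_def)
  then have D': "D 2 3 = D 3 2 + c * v x $ 1" "D 3 1 = D 1 3 + c * v x $ 2" "D 1 2 = D 2 1 + c * v x $ 3"
    by simp_all
  consider "i = 1" | "i = 2" | "i = 3" using exhaust_3 by blast
  then have "v x $ 1 * D 1 i + v x $ 2 * D 2 i + v x $ 3 * D 3 i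
      = v x $ 1 * D i 1 + v x $ 2 * D i 2 + v x $ 3 * D i 3"
    by cases (simp_all add: D' algebra_simps)
  then show ?thesis by (simp add: convective_def sum_3 D_def)
qed

lemma convective_v0_beltrami:
  assumes "\<alpha> > 0" "\<kappa>\<^sup>2 = 3" "beltrami_phases \<kappa> \<xi>"
  shows "convective (v0 \<alpha> vr \<xi>) i x =
    (\<Sum>j\<in>UNIV. v0 \<alpha> vr \<xi> x $ j * (\<alpha> * v0 \<alpha> vr \<xi> (quarter \<alpha> i x) $ j))"
  using beltrami_convective[OF curl_v0[OF assms]] by (simp add: pd_v0[OF assms(1)])

lemma beltrami_reduction_condition:
  assumes "\<alpha> > 0" "\<kappa>\<^sup>2 = 3" "beltrami_phases \<kappa> \<xi>"
  shows "reduction_condition \<alpha> (v0 \<alpha> vr \<xi>)"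
  unfolding reduction_condition_v0[OF assms(1)] convective_v0_beltrami[OF assms] v0_half_period[OF assms(1)]
  by (simp add: sum_3 algebra_simps)

lemma beltrami_pressure_integrability:
  assumes "\<alpha> > 0" "\<kappa>\<^sup>2 = 3" "beltrami_phases \<kappa> \<xi>"
  shows "pressure_integrability (v0 \<alpha> vr \<xi>)"
proof -
  let ?v = "v0 \<alpha> vr \<xi>"
  have "pd j (convective ?v i) x = (\<Sum>m\<in>UNIV.
      \<alpha> * ?v (quarter \<alpha> j x) $ m * (\<alpha> * ?v (quarter \<alpha> i x) $ m) +
      ?v x $ m * (\<alpha> * (\<alpha> * ?v (quarter \<alpha> j (quarter \<alpha> i x)) $ m)))" for i j x
  proof -
    have sh: "quarter \<alpha> i (x + t *\<^sub>R axis j 1) = quarter \<alpha> i x + t *\<^sub>R axis j 1" for t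
      by (simp add: quarter_def)
    note d = v0_directional_deriv[OF assms(1), where t = 0, simplified]
    have "((\<lambda>t. \<Sum>m\<in>UNIV. ?v (x + t *\<^sub>R axis j 1) $ m * (\<alpha> * ?v (quarter \<alpha> i x + t *\<^sub>R axis j 1) $ m))
      has_real_derivative (\<Sum>m\<in>UNIV.
      \<alpha> * ?v (quarter \<alpha> j x) $ m * (\<alpha> * ?v (quarter \<alpha> i x) $ m) +
      ?v x $ m * (\<alpha> * (\<alpha> * ?v (quarter \<alpha> j (quarter \<alpha> i x)) $ m)))) (at 0)"
      by (auto intro!: derivative_eq_intros d sum.cong)
    then show ?thesis
      unfolding pd_def convective_v0_beltrami[OF assms] sh by (rule DERIV_imp_deriv)
  qed
  then show ?thesis
    by (simp add: pressure_integrability_def quarter_commute sum_3 mult_ac)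
qed

text \<open>Expanding the square separates the three indices; it is used with the two points of a
  quarter-period pair as the two values of each index.\<close>
lemma product_difference_energy:
  fixes X X' Y Y' Z Z' :: "bool \<Rightarrow> real"
  shows "(\<Sum>i\<in>UNIV. \<Sum>j\<in>UNIV. \<Sum>k\<in>UNIV. (X i * Y j * Z k - X' i * Y' j * Z' k)\<^sup>2)
    = (\<Sum>i\<in>UNIV. (X i)\<^sup>2) * (\<Sum>j\<in>UNIV. (Y j)\<^sup>2) * (\<Sum>k\<in>UNIV. (Z k)\<^sup>2)
    + (\<Sum>i\<in>UNIV. (X' i)\<^sup>2) * (\<Sum>j\<in>UNIV. (Y' j)\<^sup>2) * (\<Sum>k\<in>UNIV. (Z' k)\<^sup>2)
    - 2 * ((\<Sum>i\<in>UNIV. X i * X' i) * (\<Sum>j\<in>UNIV. Y j * Y' j) * (\<Sum>k\<in>UNIV. Z k * Z' k))"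
  unfolding UNIV_bool by (simp add: power2_eq_square) algebra

definition profile :: "real ^ 3 \<Rightarrow> real \<Rightarrow> real \<Rightarrow> real \<Rightarrow> real" where
  "profile \<xi> y1 y2 y3 = sin (y1 + \<xi> $ 1) * cos (y2 + \<xi> $ 2) * sin (y3 + \<xi> $ 3)
      - sin (y1 + \<xi> $ 2) * sin (y2 + \<xi> $ 3) * cos (y3 + \<xi> $ 1)"

lemma v0_profile:
  "v0 \<alpha> vr \<xi> x $ 1 = vr * profile \<xi> (\<alpha> * x $ 1) (\<alpha> * x $ 2) (\<alpha> * x $ 3)"
  "v0 \<alpha> vr \<xi> x $ 2 = vr * profile \<xi> (\<alpha> * x $ 2) (\<alpha> * x $ 3) (\<alpha> * x $ 1)"
  "v0 \<alpha> vr \<xi> x $ 3 = vr * profile \<xi> (\<alpha> * x $ 3) (\<alpha> * x $ 1) (\<alpha> * x $ 2)"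
  by (simp_all add: v0_component profile_def)

text \<open>The pure squares contribute \<open>1\<close> each because a quarter-period pair sums
  \<open>sin\<^sup>2 + cos\<^sup>2\<close>; the mixed term factors into addition formulas in the phase differences.\<close>
lemma profile_energy:
  "(profile \<xi> y1 y2 y3)\<^sup>2 + (profile \<xi> y1 y2 (y3 + pi/2))\<^sup>2
   + (profile \<xi> y1 (y2 + pi/2) y3)\<^sup>2 + (profile \<xi> y1 (y2 + pi/2) (y3 + pi/2))\<^sup>2
   + (profile \<xi> (y1 + pi/2) y2 y3)\<^sup>2 + (profile \<xi> (y1 + pi/2) y2 (y3 + pi/2))\<^sup>2
   + (profile \<xi> (y1 + pi/2) (y2 + pi/2) y3)\<^sup>2 + (profile \<xi> (y1 + pi/2) (y2 + pi/2) (y3 + pi/2))\<^sup>2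
   = 2 - 2 * (cos (\<xi> $ 2 - \<xi> $ 1) * sin (\<xi> $ 3 - \<xi> $ 2) * sin (\<xi> $ 3 - \<xi> $ 1))"
proof -
  define sh :: "bool \<Rightarrow> real" where "sh b = (if b then pi/2 else 0)" for b
  have shs: "sin (y + pi/2 + a) = cos (y + a)" "cos (y + pi/2 + a) = - sin (y + a)" for y a :: real
    by (simp_all add: sin_add cos_add)
  have cs: "cos (a - b) = sin (y + b) * sin (y + a) + cos (y + b) * cos (y + a)" for a b y :: real
    using cos_diff[of "y + a" "y + b"] by simp
  have sn: "sin (a - b) = cos (y + b) * sin (y + a) - sin (y + b) * cos (y + a)" for a b y :: real
    using sin_diff[of "y + a" "y + b"] by simp
  show ?thesis
    using product_difference_energy[of
        "\<lambda>i. sin (y1 + sh i + \<xi> $ 1)" "\<lambda>j. cos (y2 + sh j + \<xi> $ 2)" "\<lambda>k. sin (y3 + sh k + \<xi> $ 3)"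
        "\<lambda>i. sin (y1 + sh i + \<xi> $ 2)" "\<lambda>j. sin (y2 + sh j + \<xi> $ 3)" "\<lambda>k. cos (y3 + sh k + \<xi> $ 1)"]
    unfolding cs[of "\<xi> $ 2" "\<xi> $ 1" y1] sn[of "\<xi> $ 3" "\<xi> $ 2" y2] sn[of "\<xi> $ 3" "\<xi> $ 1" y3]
    by (simp add: UNIV_bool sh_def shs profile_def mult_ac)
qed

lemma helicity_beltrami:
  assumes "\<alpha> > 0" "\<kappa>\<^sup>2 = 3" "beltrami_phases \<kappa> \<xi>"
  shows "helicity \<alpha> (v0 \<alpha> vr \<xi>) = - \<kappa> * (27 / 4) * (pi ^ 3 * vr\<^sup>2 / \<alpha>\<^sup>2)"
proof -
  let ?v = "v0 \<alpha> vr \<xi>"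
  obtain \<sigma> \<tau> :: real where st: "\<sigma> \<in> {-1, 1}" "\<tau> \<in> {-1, 1}"
    and p: "cos (\<xi> $ 2 - \<xi> $ 1) = - \<sigma> / 2" "sin (\<xi> $ 2 - \<xi> $ 1) = - \<sigma> * \<kappa> / 2"
    and q: "cos (\<xi> $ 3 - \<xi> $ 1) = \<tau> * \<kappa> / 2" "sin (\<xi> $ 3 - \<xi> $ 1) = \<tau> / 2"
    using assms(3) unfolding beltrami_phases_def by blast
  have "\<xi> $ 3 - \<xi> $ 2 = (\<xi> $ 3 - \<xi> $ 1) - (\<xi> $ 2 - \<xi> $ 1)" by simp
  then have r: "sin (\<xi> $ 3 - \<xi> $ 2) = \<sigma> * \<tau> / 2"
    using assms(2) by (simp only: sin_diff[of "\<xi> $ 3 - \<xi> $ 1"] p q) (simp add: field_simps power2_eq_square)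
  have "cos (\<xi> $ 2 - \<xi> $ 1) * sin (\<xi> $ 3 - \<xi> $ 2) * sin (\<xi> $ 3 - \<xi> $ 1) = - 1 / 8"
    using st by (auto simp: p q r)
  note E = profile_energy[of \<xi>, unfolded this]
  have trig: "trig \<alpha> even_freqs (\<lambda>x. complex_of_real (c * (?v x $ i)\<^sup>2))" for c i
    using trig_scale[OF trig_even[OF trig_v0[of \<alpha> vr \<xi> i] trig_v0[of \<alpha> vr \<xi> i]], of "complex_of_real c"]
    by (simp add: power2_eq_square)
  have trig3: "trig \<alpha> even_freqs (\<lambda>x. complex_of_real
      (- \<kappa> * \<alpha> * (?v x $ 1)\<^sup>2 + - \<kappa> * \<alpha> * (?v x $ 2)\<^sup>2 + - \<kappa> * \<alpha> * (?v x $ 3)\<^sup>2))"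
    unfolding of_real_add by (intro trig.add trig)
  have density: "?v x \<bullet> curl ?v x
      = - \<kappa> * \<alpha> * (?v x $ 1)\<^sup>2 + - \<kappa> * \<alpha> * (?v x $ 2)\<^sup>2 + - \<kappa> * \<alpha> * (?v x $ 3)\<^sup>2" for x
    by (simp add: curl_v0[OF assms] inner_vec_def sum_3 power2_eq_square algebra_simps)
  have sh: "\<alpha> * (y + pi / (2 * \<alpha>)) = \<alpha> * y + pi / 2" for y using assms(1) by (simp add: field_simps)
  define c where "c = - \<kappa> * \<alpha> * vr\<^sup>2"
  \<comment> \<open>The eight-point sum is independent of its base point.\<close>
  define x :: "real ^ 3" where "x = 0"
  have cE: "c * (2 - 2 * (- 1 / 8)) = c * (9 / 4)" by simp
  have "pair_sum \<alpha> 1 (pair_sum \<alpha> 2 (pair_sum \<alpha> 3 (\<lambda>x. ?v x \<bullet> curl ?v x))) x = 3 * (c * (9 / 4))"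
    using arg_cong[OF E[of "\<alpha> * x $ 1" "\<alpha> * x $ 2" "\<alpha> * x $ 3"], of "\<lambda>z. c * z"]
      arg_cong[OF E[of "\<alpha> * x $ 2" "\<alpha> * x $ 3" "\<alpha> * x $ 1"], of "\<lambda>z. c * z"]
      arg_cong[OF E[of "\<alpha> * x $ 3" "\<alpha> * x $ 1" "\<alpha> * x $ 2"], of "\<lambda>z. c * z"]
    unfolding cE distrib_left density v0_profile power_mult_distrib mult.assoc[symmetric] c_def[symmetric]
      pair_sum_def quarter_nth
    using assms(1) by (simp add: sh)
  then have "helicity \<alpha> ?v = (2*pi/\<alpha>)^3 / 8 * (3 * (- \<kappa> * \<alpha> * vr\<^sup>2 * (9 / 4)))"
    unfolding helicity_def
    by (subst cell_integral_eq_real[OF assms(1) trig3[folded density], of x]) (simp add: c_def)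
  also have "\<dots> = - \<kappa> * (27 / 4) * (pi ^ 3 * vr\<^sup>2 / \<alpha>\<^sup>2)"
    using assms(1) by (simp add: field_simps power2_eq_square power3_eq_cube)
  finally show ?thesis .
qed

section \<open>The phases allowed by the reduction condition\<close>

text \<open>Averaging the convective term over \<open>x\<^sub>1\<close>: the letters stand for the factors that do not depend
  on the first coordinate, and every pairing in the first coordinate collapses by an addition formula.\<close>
lemma paired_products:
  fixes u1 p q P Q M A B N :: real
  shows "(sin (u1 + q) * P - cos u1 * Q) * (- sin u1 * Q - sin (u1 + p) * M)
    + (cos (u1 + q) * P + sin u1 * Q) * (- cos u1 * Q - cos (u1 + p) * M)
    + (cos (u1 + p) * A - sin (u1 + q) * B) * (sin u1 * N + sin (u1 + p) * A)
    + (- sin (u1 + p) * A - cos (u1 + q) * B) * (cos u1 * N + cos (u1 + p) * A)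
   = sin p * (Q * M - A * N) - cos q * (P * Q + B * N) - cos (q - p) * (P * M + A * B)"
proof -
  have 1: "cos q = cos (u1 + q) * cos u1 + sin (u1 + q) * sin u1" using cos_diff[of "u1 + q" u1] by simp
  have 2: "cos (q - p) = cos (u1 + q) * cos (u1 + p) + sin (u1 + q) * sin (u1 + p)"
    using cos_diff[of "u1 + q" "u1 + p"] by simp
  have 3: "sin p = sin (u1 + p) * cos u1 - cos (u1 + p) * sin u1" using sin_diff[of "u1 + p" u1] by simp
  show ?thesis unfolding 1 2 3 by (simp add: algebra_simps)
qed

text \<open>The averaged first convective component is a second harmonic in \<open>x\<^sub>2\<close> plus a second harmonic
  in \<open>x\<^sub>3\<close>, with no mixed terms. Their arguments are the doubled coordinates, measured from \<open>\<xi>\<^sub>1\<close>;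
  the parameters \<open>p\<close>, \<open>q\<close> are the differences of the other phases to \<open>\<xi>\<^sub>1\<close>.\<close>
definition harmonic2 :: "real \<Rightarrow> real \<Rightarrow> real \<Rightarrow> real" where
  "harmonic2 p q Y = sin p * sin q * sin (Y + p + q) + cos q * sin (q - p) * cos (Y + p)
     - cos (q - p) * cos p * sin (Y + q)"

definition harmonic3 :: "real \<Rightarrow> real \<Rightarrow> real \<Rightarrow> real" where
  "harmonic3 p q Z = sin p * sin (p - q) * sin (Z + q) - cos q * cos p * sin (Z + p + q)
     + cos (q - p) * sin q * cos (Z + p)"

lemma double_angle_form:
  fixes p q u2 u3 :: real
  defines "P \<equiv> sin u2 * cos (u3 + p)" and "Q \<equiv> sin (u2 + p) * sin (u3 + q)"
    and "M \<equiv> cos (u2 + q) * cos u3" and "A \<equiv> sin u3 * sin (u2 + q)"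
    and "B \<equiv> sin (u3 + p) * cos u2" and "N \<equiv> cos (u2 + p) * cos (u3 + q)"
  shows "2 * (sin p * (Q * M - A * N) - cos q * (P * Q + B * N) - cos (q - p) * (P * M + A * B))
    = harmonic2 p q (2 * u2) + harmonic3 p q (2 * u3)"
proof -
  define Y Z where "Y = 2 * u2" "Z = 2 * u3"
  note YZ = this
  have ss: "2 * (sin x * sin y) = cos (x - y) - cos (x + y)" and cc: "2 * (cos x * cos y) = cos (x - y) + cos (x + y)"
    and sc: "2 * (sin x * cos y) = sin (x + y) + sin (x - y)" for x y :: real
    by (simp_all add: sin_add sin_diff cos_add cos_diff)
  have flip: "sin (p - q) = - sin (q - p)" by (simp flip: sin_minus)
  have a: "2 * (sin (u2 + p) * cos (u2 + q)) = sin (Y + p + q) - sin (q - p)"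
    "2 * (sin (u2 + q) * cos (u2 + p)) = sin (Y + p + q) + sin (q - p)"
    "2 * (sin u2 * sin (u2 + p)) = cos p - cos (Y + p)"
    "2 * (cos u2 * cos (u2 + p)) = cos p + cos (Y + p)"
    "2 * (sin u2 * cos (u2 + q)) = sin (Y + q) - sin q"
    "2 * (sin (u2 + q) * cos u2) = sin (Y + q) + sin q"
    and b: "2 * (sin (u3 + q) * cos u3) = sin (Z + q) + sin q"
    "2 * (sin u3 * cos (u3 + q)) = sin (Z + q) - sin q"
    "2 * (sin (u3 + q) * cos (u3 + p)) = sin (Z + p + q) + sin (q - p)"
    "2 * (sin (u3 + p) * cos (u3 + q)) = sin (Z + p + q) - sin (q - p)"
    "2 * (cos (u3 + p) * cos u3) = cos (Z + p) + cos p"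
    "2 * (sin u3 * sin (u3 + p)) = cos p - cos (Z + p)"
    unfolding ss cc sc YZ by (simp_all add: algebra_simps flip)
  have 1: "2 * (Q * M - A * N) = sin (Y + p + q) * sin q - sin (q - p) * sin (Z + q)"
    using arg_cong2[OF a(1) b(1), of "(*)"] arg_cong2[OF a(2) b(2), of "(*)"]
    by (simp add: Q_def M_def A_def N_def algebra_simps)
  have 2: "2 * (P * Q + B * N) = cos p * sin (Z + p + q) - cos (Y + p) * sin (q - p)"
    using arg_cong2[OF a(3) b(3), of "(*)"] arg_cong2[OF a(4) b(4), of "(*)"]
    by (simp add: P_def Q_def B_def N_def algebra_simps)
  have 3: "2 * (P * M + A * B) = sin (Y + q) * cos p - sin q * cos (Z + p)"
    using arg_cong2[OF a(5) b(5), of "(*)"] arg_cong2[OF a(6) b(6), of "(*)"]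
    by (simp add: P_def M_def A_def B_def algebra_simps)
  have "2 * (sin p * (Q * M - A * N) - cos q * (P * Q + B * N) - cos (q - p) * (P * M + A * B))
      = sin p * (2 * (Q * M - A * N)) - cos q * (2 * (P * Q + B * N)) - cos (q - p) * (2 * (P * M + A * B))"
    by (simp add: algebra_simps)
  also have "\<dots> = harmonic2 p q Y + harmonic3 p q Z"
    unfolding 1 2 3 harmonic2_def harmonic3_def flip by (simp add: algebra_simps)
  finally show ?thesis by (simp add: YZ)
qed

text \<open>A harmonic changes sign under a shift of its argument by \<open>\<pi>\<close>, hence a vanishing sum makes both
  vanish. Evaluating them at arguments where \<open>cos\<close> or \<open>sin\<close> of that argument plus \<open>p\<close> disappears gives the equations.\<close>
lemma phase_equations:
  assumes "\<And>Y Z. harmonic2 p q Y + harmonic3 p q Z = 0"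
  shows "sin p * ((sin q)\<^sup>2 - (sin (q - p))\<^sup>2) = 0"
    and "sin p * sin q * cos q = cos p * (cos (q - p))\<^sup>2"
    and "- (sin p * sin (q - p) * cos (q - p)) = cos p * (cos q)\<^sup>2"
proof -
  have flip: "harmonic2 p q (Y + pi) = - harmonic2 p q Y" for Y
  proof -
    have "Y + pi + p + q = (Y + p + q) + pi" "Y + pi + p = (Y + p) + pi" "Y + pi + q = (Y + q) + pi" by simp_all
    then show ?thesis by (simp only: harmonic2_def sin_periodic_pi cos_periodic_pi)
  qed
  have h2: "harmonic2 p q Y = 0" and h3: "harmonic3 p q Z = 0" for Y Z
    using assms[of Y Z] assms[of "Y + pi" Z] by (auto simp: flip)
  define r where "r = q - p"
  have arg: "- p + p + q = q" "- p + q = r" "pi/2 - p + p + q = pi/2 + q" "pi/2 - p + q = pi/2 + r"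
    "pi/2 - p + p = pi/2" "p - q = - r" by (simp_all add: r_def)
  have cq: "cos q = cos r * cos p - sin r * sin p" using cos_add[of r p] by (simp add: r_def)
  have sh: "sin (pi/2 + x) = cos x" for x :: real by (simp add: sin_add)
  have "sin p * (sin q)\<^sup>2 + cos q * sin r - cos r * cos p * sin r = 0"
    using h2[of "- p"] by (simp add: harmonic2_def arg r_def[symmetric] power2_eq_square)
  then show "sin p * ((sin q)\<^sup>2 - (sin (q - p))\<^sup>2) = 0"
    unfolding r_def[symmetric] cq by (simp add: power2_eq_square algebra_simps)
  show "sin p * sin q * cos q = cos p * (cos (q - p))\<^sup>2"
    using h2[of "pi/2 - p"]
    unfolding harmonic2_def arg sh r_def[symmetric] by (simp add: power2_eq_square algebra_simps)
  show "- (sin p * sin (q - p) * cos (q - p)) = cos p * (cos q)\<^sup>2"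
    using h3[of "pi/2 - p"]
    unfolding harmonic3_def arg sh r_def[symmetric] by (simp add: power2_eq_square algebra_simps)
qed

text \<open>If \<open>sin p \<noteq> 0\<close>, the first equation gives \<open>cos\<^sup>2 q = cos\<^sup>2 (q - p)\<close>; cancelling \<open>cos q\<close> in the
  second gives \<open>sin p sin q = cos p cos q\<close>, and then \<open>cos (q - p) = 2 cos p cos q\<close> forces \<open>cos\<^sup>2 p = 1 / 4\<close>,
  that is \<open>tan p = \<plusminus> sqrt 3\<close>. The case \<open>sin p = 0\<close> is the one in which the field vanishes
  identically.\<close>
lemma phase_solutions:
  fixes p q :: real
  assumes e0: "sin p * ((sin q)\<^sup>2 - (sin (q - p))\<^sup>2) = 0"
    and e1: "sin p * sin q * cos q = cos p * (cos (q - p))\<^sup>2"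
    and e2: "- (sin p * sin (q - p) * cos (q - p)) = cos p * (cos q)\<^sup>2"
  obtains "sin p = 0" "cos q = 0"
  | \<kappa> where "\<kappa> \<in> {sqrt 3, - sqrt 3}" "sin p = \<kappa> * cos p" "cos q = \<kappa> * sin q"
proof (cases "sin p = 0")
  case True
  then have "cos p \<noteq> 0" using sin_cos_squared_add[of p] by auto
  then show thesis using e2 True that(1) by simp
next
  case False
  define r where "r = q - p"
  have cr: "cos r = cos q * cos p + sin q * sin p" by (simp add: r_def cos_diff)
  have "(sin q)\<^sup>2 = (sin r)\<^sup>2" using e0 False by (simp add: r_def)
  then have c2: "(cos q)\<^sup>2 = (cos r)\<^sup>2" by (simp add: cos_squared_eq)
  have e1': "sin p * sin q * cos q = cos p * (cos q)\<^sup>2" using e1 c2 by (simp add: r_def)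
  have cq: "cos q \<noteq> 0"
  proof
    assume "cos q = 0"
    with c2 cr have "sin q * sin p = 0" by simp
    with \<open>cos q = 0\<close> False show False using sin_cos_squared_add[of q] by auto
  qed
  have k: "sin p * sin q = cos p * cos q" using e1' cq by (simp add: power2_eq_square)
  have "cos r = 2 * cos p * cos q" unfolding cr using k by (simp add: mult_ac)
  with c2 have "(4 * (cos p)\<^sup>2) * (cos q)\<^sup>2 = 1 * (cos q)\<^sup>2" by (simp add: power_mult_distrib)
  then have cp: "4 * (cos p)\<^sup>2 = 1" using cq by (simp only: mult_cancel_right) simp
  then have cp0: "cos p \<noteq> 0" by auto
  have "(sin p)\<^sup>2 = 3 * (cos p)\<^sup>2" using cp by (simp add: sin_squared_eq)
  then have "(sin p)\<^sup>2 = (sqrt 3 * cos p)\<^sup>2" by (simp add: power_mult_distrib)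
  then have "sin p = sqrt 3 * cos p \<or> sin p = - sqrt 3 * cos p"
    by (simp add: power2_eq_iff)
  then obtain \<kappa> where \<kappa>: "\<kappa> \<in> {sqrt 3, - sqrt 3}" "sin p = \<kappa> * cos p"
    by blast
  then have "cos q = \<kappa> * sin q" using k cp0 by auto
  with \<kappa> show thesis by (rule that(2))
qed

lemma reduction_condition_harmonics:
  assumes "\<alpha> > 0" "vr \<noteq> 0" "reduction_condition \<alpha> (v0 \<alpha> vr \<xi>)"
  shows "harmonic2 (\<xi> $ 2 - \<xi> $ 1) (\<xi> $ 3 - \<xi> $ 1) Y + harmonic3 (\<xi> $ 2 - \<xi> $ 1) (\<xi> $ 3 - \<xi> $ 1) Z = 0"
proof -
  define a p q where "a = \<xi> $ 1" and p_def: "p = \<xi> $ 2 - \<xi> $ 1" and q_def: "q = \<xi> $ 3 - \<xi> $ 1"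
  note a_def = this(1)
  \<comment> \<open>The base point at which the phases take the values \<open>u\<^sub>j\<close>; after averaging over \<open>x\<^sub>1\<close> any \<open>u\<^sub>1\<close> will do.\<close>
  define u1 u2 u3 :: real where "u1 = 0" and u2_def: "u2 = Y / 2" and u3_def: "u3 = Z / 2"
  define x :: "real ^ 3" where "x = vector [(u1 - a) / \<alpha>, (u2 - a) / \<alpha>, (u3 - a) / \<alpha>]"
  let ?v = "v0 \<alpha> vr \<xi>"
  have \<alpha>: "\<alpha> \<noteq> 0" using assms(1) by simp
  have phases: "\<alpha> * x $ 1 + \<xi> $ 1 = u1" "\<alpha> * x $ 1 + \<xi> $ 2 = u1 + p" "\<alpha> * x $ 1 + \<xi> $ 3 = u1 + q"
    "\<alpha> * x $ 2 + \<xi> $ 1 = u2" "\<alpha> * x $ 2 + \<xi> $ 2 = u2 + p" "\<alpha> * x $ 2 + \<xi> $ 3 = u2 + q"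
    "\<alpha> * x $ 3 + \<xi> $ 1 = u3" "\<alpha> * x $ 3 + \<xi> $ 2 = u3 + p" "\<alpha> * x $ 3 + \<xi> $ 3 = u3 + q"
    using \<alpha> by (simp_all add: x_def a_def p_def q_def)
  have "convective ?v 1 x + convective ?v 1 (quarter \<alpha> 1 x) = 0"
    using assms(3) unfolding reduction_condition_v0[OF assms(1)] by simp
  then have "\<alpha> * (?v x $ 2 * ?v (quarter \<alpha> 2 x) $ 1 + ?v (quarter \<alpha> 1 x) $ 2 * ?v (quarter \<alpha> 2 (quarter \<alpha> 1 x)) $ 1
     + ?v x $ 3 * ?v (quarter \<alpha> 3 x) $ 1 + ?v (quarter \<alpha> 1 x) $ 3 * ?v (quarter \<alpha> 3 (quarter \<alpha> 1 x)) $ 1) = 0"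
    unfolding convective_v0[OF assms(1)] sum_3 v0_half_period[OF assms(1)] by (simp add: algebra_simps)
  then have vanish: "?v x $ 2 * ?v (quarter \<alpha> 2 x) $ 1 + ?v (quarter \<alpha> 1 x) $ 2 * ?v (quarter \<alpha> 2 (quarter \<alpha> 1 x)) $ 1
     + ?v x $ 3 * ?v (quarter \<alpha> 3 x) $ 1 + ?v (quarter \<alpha> 1 x) $ 3 * ?v (quarter \<alpha> 3 (quarter \<alpha> 1 x)) $ 1 = 0"
    using \<alpha> by simp
  define P where "P = sin u2 * cos (u3 + p)"
  define Q where "Q = sin (u2 + p) * sin (u3 + q)"
  define M where "M = cos (u2 + q) * cos u3"
  define A where "A = sin u3 * sin (u2 + q)"
  define B where "B = sin (u3 + p) * cos u2"
  define N where "N = cos (u2 + p) * cos (u3 + q)"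
  note defs = P_def Q_def M_def A_def B_def N_def
  let ?S = "sin p * (Q * M - A * N) - cos q * (P * Q + B * N) - cos (q - p) * (P * M + A * B)"
  note vals = v0_component quarter_nth sin_quarter[OF \<alpha>] cos_quarter[OF \<alpha>] phases
  have V: "?v x $ 2 = vr * (sin (u1 + q) * P - cos u1 * Q)"
    "?v (quarter \<alpha> 2 x) $ 1 = vr * (- sin u1 * Q - sin (u1 + p) * M)"
    "?v (quarter \<alpha> 1 x) $ 2 = vr * (cos (u1 + q) * P + sin u1 * Q)"
    "?v (quarter \<alpha> 2 (quarter \<alpha> 1 x)) $ 1 = vr * (- cos u1 * Q - cos (u1 + p) * M)"
    "?v x $ 3 = vr * (cos (u1 + p) * A - sin (u1 + q) * B)"
    "?v (quarter \<alpha> 3 x) $ 1 = vr * (sin u1 * N + sin (u1 + p) * A)"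
    "?v (quarter \<alpha> 1 x) $ 3 = vr * (- sin (u1 + p) * A - cos (u1 + q) * B)"
    "?v (quarter \<alpha> 3 (quarter \<alpha> 1 x)) $ 1 = vr * (cos u1 * N + cos (u1 + p) * A)"
    by (simp_all add: vals) (simp_all add: defs algebra_simps)
  have "vr\<^sup>2 * ?S = ?v x $ 2 * ?v (quarter \<alpha> 2 x) $ 1 + ?v (quarter \<alpha> 1 x) $ 2 * ?v (quarter \<alpha> 2 (quarter \<alpha> 1 x)) $ 1
     + ?v x $ 3 * ?v (quarter \<alpha> 3 x) $ 1 + ?v (quarter \<alpha> 1 x) $ 3 * ?v (quarter \<alpha> 3 (quarter \<alpha> 1 x)) $ 1"
    unfolding V paired_products[of u1 q P Q p M A B N, symmetric]
    by (simp add: power2_eq_square algebra_simps)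
  then have "vr\<^sup>2 * ?S = 0" using vanish by simp
  then have "?S = 0" using assms(2) by simp
  then have "harmonic2 p q (2 * u2) + harmonic3 p q (2 * u3) = 0"
    using double_angle_form[of p u2 u3 q, folded defs] by simp
  then show ?thesis by (simp add: p_def q_def u2_def u3_def)
qed

lemma reduction_condition_phases:
  assumes "\<alpha> > 0" "vr \<noteq> 0" "reduction_condition \<alpha> (v0 \<alpha> vr \<xi>)" "v0 \<alpha> vr \<xi> x \<noteq> 0"
  shows "\<xi> \<in> first_family \<union> second_family"
proof -
  define p q where "p = \<xi> $ 2 - \<xi> $ 1" and "q = \<xi> $ 3 - \<xi> $ 1"
  note pq = this
  have "harmonic2 p q Y + harmonic3 p q Z = 0" for Y Z
    unfolding pq by (rule reduction_condition_harmonics[OF assms(1-3)])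
  note equations = phase_equations[OF this]
  from equations show ?thesis
  proof (cases rule: phase_solutions)
    case 1
    have shift: "y + \<xi> $ 2 = (y + \<xi> $ 1) + p" "y + \<xi> $ 3 = (y + \<xi> $ 1) + q" for y by (simp_all add: pq)
    have "v0 \<alpha> vr \<xi> x = 0"
      unfolding vec_eq_iff forall_3 v0_component shift sin_add[of _ p] cos_add[of _ p] sin_add[of _ q]
      by (simp add: 1)
    with assms(4) show ?thesis by simp
  next
    case (2 \<kappa>)
    then consider "\<kappa> = sqrt 3" | "\<kappa> = - sqrt 3" by blast
    then show ?thesis
    proof cases
      case 1
      have "sin (p + 2 * pi / 3) = 0" "sin (q - pi / 6) = 0"
        unfolding sin_add sin_diff using 2 1 by (simp_all add: sin_120 cos_120 sin_30 cos_30)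
      then obtain l1 l2 :: int where "p + 2 * pi / 3 = of_int l1 * pi" "q - pi / 6 = of_int l2 * pi"
        unfolding sin_zero_iff_int2 by blast
      then have "\<xi> = vector [\<xi> $ 1, \<xi> $ 1 - 2 * pi / 3 + of_int l1 * pi, \<xi> $ 1 + pi / 6 + of_int l2 * pi]"
        by (simp add: vec_eq_iff forall_3 pq)
      then show ?thesis unfolding first_family_def by blast
    next
      case neg: 2
      have "sin (p - 2 * pi / 3) = 0" "sin (q - 5 * pi / 6) = 0"
        unfolding sin_add sin_diff using 2 neg by (simp_all add: sin_120 cos_120 sin_150 cos_150)
      then obtain l1 l2 :: int where "p - 2 * pi / 3 = of_int l1 * pi" "q - 5 * pi / 6 = of_int l2 * pi"
        unfolding sin_zero_iff_int2 by blast
      then have "\<xi> = vector [\<xi> $ 1, \<xi> $ 1 + 2 * pi / 3 + of_int l1 * pi, \<xi> $ 1 + 5 * pi / 6 + of_int l2 * pi]"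
        by (simp add: vec_eq_iff forall_3 pq)
      then show ?thesis unfolding second_family_def by blast
    qed
  qed
qed

section \<open>Covariance of the curl under rigid motions\<close>

unbundle cross3_syntax

lemma pd_eq_derivative:
  assumes "(v has_derivative D) (at x)"
  shows "pd j (\<lambda>y. v y $ i) x = D (axis j 1) $ i"
proof -
  interpret D: bounded_linear D using assms by (rule has_derivative_bounded_linear)
  have line: "((\<lambda>t. x + t *\<^sub>R axis j 1) has_derivative (\<lambda>t. t *\<^sub>R axis j 1)) (at 0)"
    by (auto intro!: derivative_eq_intros)
  have "((\<lambda>t. v (x + t *\<^sub>R axis j 1)) has_derivative (\<lambda>t. D (t *\<^sub>R axis j 1))) (at 0)"
    using has_derivative_compose[OF line, of v D] assms by simp
  then have "((\<lambda>t. v (x + t *\<^sub>R axis j 1) $ i) has_derivative (\<lambda>t. D (t *\<^sub>R axis j 1) $ i)) (at 0)"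
    by (rule bounded_linear.has_derivative[OF bounded_linear_vec_nth])
  then have "((\<lambda>t. v (x + t *\<^sub>R axis j 1) $ i) has_real_derivative D (axis j 1) $ i) (at 0)"
    by (simp add: has_field_derivative_def D.scaleR mult.commute[of _ "D (axis j 1) $ i"])
  then show ?thesis unfolding pd_def by (rule DERIV_imp_deriv)
qed

text \<open>Written this way the curl is a trace of the bilinear map \<open>(h, k) \<mapsto> h \<times> D k\<close>, and a trace may be
  computed in any orthonormal basis.\<close>
lemma curl_eq_derivative:
  assumes "(v has_derivative D) (at x)"
  shows "curl v x = (\<Sum>j\<in>UNIV. axis j 1 \<times> D (axis j 1))"
  unfolding curl_def pd_eq_derivative[OF assms]
  by (simp add: vec_eq_iff forall_3 sum_3 cross_components axis_def)

lemma bilinear_trace_orthogonal: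
  fixes B :: "real ^ 'n \<Rightarrow> real ^ 'n \<Rightarrow> 'b::real_vector" and R :: "real ^ 'n ^ 'n"
  assumes B: "bilinear B" and R: "orthogonal_matrix R"
  shows "(\<Sum>j\<in>UNIV. B (R *v axis j 1) (R *v axis j 1)) = (\<Sum>k\<in>UNIV. B (axis k 1) (axis k 1))"
proof -
  have col: "R *v axis j 1 = (\<Sum>k\<in>UNIV. R $ k $ j *\<^sub>R axis k 1)" for j
    unfolding matrix_vector_mult_basis by (simp add: vec_eq_iff column_def axis_def if_distrib[of "\<lambda>c. _ * c"] cong: if_cong)
  have RR: "(\<Sum>j\<in>UNIV. R $ k $ j * R $ l $ j) = (if k = l then 1 else 0)" for k l
  proof -
    have "(R ** transpose R) $ k $ l = (mat 1 :: real^'n^'n) $ k $ l"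
      using R by (simp add: orthogonal_matrix_def)
    then show ?thesis by (simp add: matrix_matrix_mult_def transpose_def mat_def)
  qed
  have "(\<Sum>j\<in>UNIV. B (R *v axis j 1) (R *v axis j 1))
      = (\<Sum>j\<in>UNIV. \<Sum>k\<in>UNIV. \<Sum>l\<in>UNIV. (R $ k $ j * R $ l $ j) *\<^sub>R B (axis k 1) (axis l 1))"
    unfolding col bilinear_sum[OF B] sum.cartesian_product[symmetric]
    by (simp add: bilinear_lmul[OF B] bilinear_rmul[OF B] mult.commute)
  also have "\<dots> = (\<Sum>k\<in>UNIV. \<Sum>l\<in>UNIV. \<Sum>j\<in>UNIV. (R $ k $ j * R $ l $ j) *\<^sub>R B (axis k 1) (axis l 1))"
    by (rule trans[OF sum.swap], rule sum.cong[OF refl], rule sum.swap)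
  also have "\<dots> = (\<Sum>k\<in>UNIV. \<Sum>l\<in>UNIV. (if k = l then 1 else 0) *\<^sub>R B (axis k 1) (axis l 1))"
    by (simp add: RR flip: scaleR_sum_left)
  also have "\<dots> = (\<Sum>k\<in>UNIV. B (axis k 1) (axis k 1))"
    by (simp add: if_distrib[of "\<lambda>c. c *\<^sub>R _"] cong: if_cong)
  finally show ?thesis .
qed

text \<open>Evaluating the trace at the image point in the rotated basis, the factor \<open>R\<close> comes out of the
  cross product because \<open>R\<close> is a proper rotation.\<close>
lemma curl_carries:
  assumes R: "rotation_matrix R" and c: "carries R a v w"
    and v: "v differentiable (at x)" and w: "w differentiable (at (R *v x + a))"
  shows "curl w (R *v x + a) = R *v curl v x"
proof -
  obtain D where D: "(v has_derivative D) (at x)" using v by (auto simp: differentiable_def)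
  obtain E where E: "(w has_derivative E) (at (R *v x + a))" using w by (auto simp: differentiable_def)
  have orth: "orthogonal_matrix R" using R by (simp add: rotation_matrix_def)
  have lin: "bounded_linear ((*v) R)" by (rule matrix_vector_mul_bounded_linear)
  have motion: "((\<lambda>y. R *v y + a) has_derivative (\<lambda>h. R *v h)) (at x)"
    using bounded_linear.has_derivative[OF lin has_derivative_ident] by (auto intro!: derivative_eq_intros)
  have "((\<lambda>y. w (R *v y + a)) has_derivative (\<lambda>h. E (R *v h))) (at x)"
    using has_derivative_compose[OF motion, of w E] E by simp
  moreover have "((\<lambda>y. w (R *v y + a)) has_derivative (\<lambda>h. R *v D h)) (at x)"
    using bounded_linear.has_derivative[OF lin D] c by (simp add: carries_def)
  ultimately have ED: "E (R *v h) = R *v D h" for h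
    by (metis has_derivative_unique)
  have linE: "linear E" using E by (rule has_derivative_linear)
  have bil: "bilinear (\<lambda>h k. h \<times> E k)"
    unfolding bilinear_def using linE
    by (auto simp: linear_iff cross_add_left cross_add_right cross_mult_left cross_mult_right)
  have "curl w (R *v x + a) = (\<Sum>j\<in>UNIV. (R *v axis j 1) \<times> E (R *v axis j 1))"
    unfolding curl_eq_derivative[OF E] bilinear_trace_orthogonal[OF bil orth] ..
  also have "\<dots> = (\<Sum>j\<in>UNIV. R *v (axis j 1 \<times> D (axis j 1)))"
    by (simp add: ED cross_rotation_matrix[OF R])
  also have "\<dots> = R *v curl v x"
    unfolding curl_eq_derivative[OF D] by (simp add: sum_3 matrix_vector_right_distrib)
  finally show ?thesis .
qed

lemma v0_differentiable: "v0 \<alpha> vr \<xi> differentiable (at x)"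
proof -
  have nth: "(\<lambda>y::real^3. y $ i) differentiable (at x)" for i
    using bounded_linear_imp_differentiable[OF bounded_linear_vec_nth] by blast
  have phase: "(\<lambda>y::real^3. \<alpha> * y $ i + \<phi>) differentiable (at x)" for i \<phi>
    by (intro differentiable_add differentiable_mult differentiable_const nth)
  have "sin differentiable (at z)" "cos differentiable (at z)" for z :: real
    unfolding real_differentiable_def using DERIV_sin DERIV_cos by blast+
  then have s: "(\<lambda>y::real^3. sin (\<alpha> * y $ i + \<phi>)) differentiable (at x)"
    and k: "(\<lambda>y::real^3. cos (\<alpha> * y $ i + \<phi>)) differentiable (at x)" for i \<phi>
    using phase by (auto intro: differentiable_compose)
  have comp: "(\<lambda>y. v0 \<alpha> vr \<xi> y $ i) differentiable (at x)" for i
  proof -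
    consider "i = 1" | "i = 2" | "i = 3" using exhaust_3 by blast
    then show ?thesis
      by cases (simp_all only: v0_component,
        (intro differentiable_mult differentiable_diff differentiable_const s k)+)
  qed
  have "(\<lambda>y. \<Sum>i\<in>UNIV. v0 \<alpha> vr \<xi> y $ i *\<^sub>R axis i (1::real)) differentiable (at x)"
    by (intro differentiable_sum ballI differentiable_scaleR comp differentiable_const finite)
  moreover have "(\<lambda>y. \<Sum>i\<in>UNIV. v0 \<alpha> vr \<xi> y $ i *\<^sub>R axis i (1::real)) = v0 \<alpha> vr \<xi>"
    by (simp add: fun_eq_iff basis_expansion flip: scalar_mult_eq_scaleR)
  ultimately show ?thesis by simp
qed

text \<open>Motions preserve the eigenvalue of the curl, so a field carried to one with a different
  eigenvalue vanishes.\<close>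
lemma not_carries:
  assumes R: "rotation_matrix R" and c: "carries R a v w"
    and v: "\<And>x. v differentiable (at x)" "\<And>x. curl v x = l *\<^sub>R v x"
    and w: "\<And>x. w differentiable (at x)" "\<And>x. curl w x = m *\<^sub>R w x"
    and "l \<noteq> m"
  shows "v x = 0"
proof -
  have "m *\<^sub>R (R *v v x) = l *\<^sub>R (R *v v x)"
    using curl_carries[OF R c v(1) w(1), of x] c v(2) w(2)
    by (simp add: carries_def matrix_vector_mult_scaleR)
  then have "R *v v x = 0" using \<open>l \<noteq> m\<close> by simp
  moreover have "transpose R *v (R *v v x) = v x"
    using R by (simp add: matrix_vector_mul_assoc rotation_matrix_def orthogonal_matrix_def)
  ultimately show ?thesis by simp
qed

lemma helicity_nonzero_imp:
  assumes "helicity \<alpha> v \<noteq> 0" obtains x where "v x \<noteq> 0"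
proof -
  have "\<exists>x. v x \<noteq> 0"
  proof (rule ccontr)
    assume "\<nexists>x. v x \<noteq> 0"
    then have "helicity \<alpha> v = 0" by (simp add: helicity_def)
    with assms show False by simp
  qed
  with that show thesis by blast
qed

lemma families_not_carried:
  assumes "\<alpha> > 0" "vr \<noteq> 0" "\<kappa>\<^sup>2 = 3" "\<mu>\<^sup>2 = 3" "\<kappa> \<noteq> \<mu>"
    "beltrami_phases \<kappa> \<xi>" "beltrami_phases \<mu> \<eta>" "rotation_matrix R"
  shows "\<not> carries R a (v0 \<alpha> vr \<xi>) (v0 \<alpha> vr \<eta>)"
proof
  assume c: "carries R a (v0 \<alpha> vr \<xi>) (v0 \<alpha> vr \<eta>)"
  \<comment> \<open>A nonzero helicity shows that the field does not vanish identically.\<close>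
  have "helicity \<alpha> (v0 \<alpha> vr \<xi>) \<noteq> 0"
    using assms(1,2,3) by (auto simp: helicity_beltrami[OF assms(1,3,6)])
  then obtain x where "v0 \<alpha> vr \<xi> x \<noteq> 0" by (rule helicity_nonzero_imp)
  moreover have "v0 \<alpha> vr \<xi> x = 0"
    by (rule not_carries[OF assms(8) c v0_differentiable curl_v0[OF assms(1,3,6)]
          v0_differentiable curl_v0[OF assms(1,4,7)]]) (use assms(1,5) in simp)
  ultimately show False by simp
qed

section \<open>The classification\<close>

theorem mainTheorem3:
  fixes \<alpha> vr :: real
  assumes "\<alpha> > 0" and "vr > 0"
  shows
    "(\<forall>\<xi> :: real ^ 3. reduction_condition \<alpha> (v0 \<alpha> vr \<xi>) \<and> (\<exists>x. v0 \<alpha> vr \<xi> x \<noteq> 0)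
        \<longrightarrow> \<xi> \<in> first_family \<union> second_family)
   \<and> (\<forall>\<xi> \<in> first_family \<union> second_family.
        reduction_condition \<alpha> (v0 \<alpha> vr \<xi>) \<and> pressure_integrability (v0 \<alpha> vr \<xi>))
   \<and> (\<forall>\<xi> \<in> first_family.
        helicity \<alpha> (v0 \<alpha> vr \<xi>) = - (27 * sqrt 3 / 4) * (pi ^ 3 * vr ^ 2 / \<alpha> ^ 2))
   \<and> (\<forall>\<xi> \<in> second_family.
        helicity \<alpha> (v0 \<alpha> vr \<xi>) = 27 * sqrt 3 / 4 * (pi ^ 3 * vr ^ 2 / \<alpha> ^ 2))
   \<and> (\<forall>\<xi> \<in> first_family. \<forall>\<eta> \<in> second_family. \<forall>R a. rotation_matrix R \<longrightarrow>
        \<not> carries R a (v0 \<alpha> vr \<xi>) (v0 \<alpha> vr \<eta>) \<and> \<not> carries R a (v0 \<alpha> vr \<eta>) (v0 \<alpha> vr \<xi>))"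
proof -
  have vr: "vr \<noteq> 0" and k: "(sqrt 3)\<^sup>2 = 3" "(- sqrt 3)\<^sup>2 = 3" "sqrt 3 \<noteq> - sqrt 3"
    using assms(2) by auto
  note beltrami = first_family_beltrami second_family_beltrami
  show ?thesis
  proof (intro conjI allI ballI impI; (elim conjE exE)?)
    fix \<xi> x assume "reduction_condition \<alpha> (v0 \<alpha> vr \<xi>)" "v0 \<alpha> vr \<xi> x \<noteq> 0"
    then show "\<xi> \<in> first_family \<union> second_family"
      by (rule reduction_condition_phases[OF assms(1) vr])
  next
    fix \<xi> assume "\<xi> \<in> first_family \<union> second_family"
    then show "reduction_condition \<alpha> (v0 \<alpha> vr \<xi>)"
      using beltrami_reduction_condition[OF assms(1)] beltrami k by blast
  next
    fix \<xi> assume "\<xi> \<in> first_family \<union> second_family"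
    then show "pressure_integrability (v0 \<alpha> vr \<xi>)"
      using beltrami_pressure_integrability[OF assms(1)] beltrami k by blast
  next
    fix \<xi> assume "\<xi> \<in> first_family"
    from helicity_beltrami[OF assms(1) k(1) beltrami(1)[OF this]]
    show "helicity \<alpha> (v0 \<alpha> vr \<xi>) = - (27 * sqrt 3 / 4) * (pi ^ 3 * vr ^ 2 / \<alpha> ^ 2)" by simp
  next
    fix \<xi> assume "\<xi> \<in> second_family"
    from helicity_beltrami[OF assms(1) k(2) beltrami(2)[OF this]]
    show "helicity \<alpha> (v0 \<alpha> vr \<xi>) = 27 * sqrt 3 / 4 * (pi ^ 3 * vr ^ 2 / \<alpha> ^ 2)" by simp
  next
    fix \<xi> \<eta> a and R :: "real ^ 3 ^ 3"
    assume "\<xi> \<in> first_family" "\<eta> \<in> second_family" "rotation_matrix R"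
    then show "\<not> carries R a (v0 \<alpha> vr \<xi>) (v0 \<alpha> vr \<eta>)"
      using families_not_carried[OF assms(1) vr k] beltrami by blast
  next
    fix \<xi> \<eta> a and R :: "real ^ 3 ^ 3"
    assume "\<xi> \<in> first_family" "\<eta> \<in> second_family" "rotation_matrix R"
    then show "\<not> carries R a (v0 \<alpha> vr \<eta>) (v0 \<alpha> vr \<xi>)"
      using families_not_carried[OF assms(1) vr k(2,1) k(3)[symmetric]] beltrami by blast
  qed
qed

end
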